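(* Let $\kappa\in(0,1)$ and $\lambda=\sqrt{1-\kappa^2}$, and let $y_4^+$, $\Omega$, $\Omega'$ be as defined in the context. Then the function $y_4^+$ has a zero at $\tfrac12\Omega+\Omega'$ and a pole at $\tfrac12\Omega$.
   Context: Let $T_4(t)=8t^4-8t^2+1$ be the degree-four Chebyshev polynomial of the first kind. Let $y_4^+$ be the nonconstant meromorphic (on $\mathbb{C}$) solution of $(y')^2=T_4(y)-(1-2\lambda^2)=8y^4-8y^2+2\lambda^2$ with $y(0)=\sqrt{\tfrac12(1+\kappa)}$; it is an elliptic function. It shares its period lattice with the Weierstrass function $P=\wp(\bullet;G_2,G_3)$ with invariants $G_2=\tfrac{16}{3}(1+3\lambda^2)$, $G_3=\tfrac{64}{27}(1-9\lambda^2)$. This lattice is rectangular, and $(2\Omega,2\Omega')$ denotes the fundamental pair of periods for which $\Omega>0$ and $-\mathrm{i}\,\Omega'>0$. *)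

theory Defs
  imports "HOL-Complex_Analysis.Complex_Analysis"
begin

definition chebyshev_T4 :: "complex \<Rightarrow> complex" where
  "chebyshev_T4 t = 8 * t ^ 4 - 8 * t ^ 2 + 1"

definition lattice_gen :: "complex \<Rightarrow> complex \<Rightarrow> complex set" where
  "lattice_gen a b = {of_int m * a + of_int n * b | m n. True}"

(* b / a \<notin> \<real> says that a and b are linearly independent over the reals;
   since b / 0 = 0, it also excludes a = 0. *)
definition is_lattice :: "complex set \<Rightarrow> bool" where
  "is_lattice L \<longleftrightarrow> (\<exists>a b. b / a \<notin> \<real> \<and> L = lattice_gen a b)"

definition lattice_invariant_g2 :: "complex set \<Rightarrow> complex" where
  "lattice_invariant_g2 L = 60 * (\<Sum>\<^sub>\<infinity>w\<in>L - {0}. 1 / w ^ 4)"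

definition lattice_invariant_g3 :: "complex set \<Rightarrow> complex" where
  "lattice_invariant_g3 L = 140 * (\<Sum>\<^sub>\<infinity>w\<in>L - {0}. 1 / w ^ 6)"

(* The value 0 at the poles is the convention of nicely_meromorphic_on. *)
definition weierstrass_p :: "complex set \<Rightarrow> complex \<Rightarrow> complex" where
  "weierstrass_p L z =
     (if z \<in> L then 0
      else 1 / z ^ 2 + (\<Sum>\<^sub>\<infinity>w\<in>L - {0}. (1 / (z - w) ^ 2 - 1 / w ^ 2)))"

definition is_weierstrass_p_with_invariants ::
    "(complex \<Rightarrow> complex) \<Rightarrow> complex \<Rightarrow> complex \<Rightarrow> bool" where
  "is_weierstrass_p_with_invariants P G2 G3 \<longleftrightarrow>
     (\<exists>L. is_lattice L \<and> lattice_invariant_g2 L = G2 \<and> lattice_invariant_g3 L = G3 \<and>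
          P = weierstrass_p L)"

definition periods :: "(complex \<Rightarrow> complex) \<Rightarrow> complex set" where
  "periods f = {w. \<forall>z. f (z + w) = f z}"

definition fundamental_pair_of_periods ::
    "(complex \<Rightarrow> complex) \<Rightarrow> complex \<Rightarrow> complex \<Rightarrow> bool" where
  "fundamental_pair_of_periods f a b \<longleftrightarrow> b / a \<notin> \<real> \<and> periods f = lattice_gen a b"

(* The differential equation is required at the points where y is finite.
   Together with nicely_meromorphic_on, not being a pole of y means being
   a point of analyticity of y. *)
definition meromorphic_T4_solution :: "real \<Rightarrow> (complex \<Rightarrow> complex) \<Rightarrow> bool" where
  "meromorphic_T4_solution l y \<longleftrightarrow>
     y nicely_meromorphic_on UNIV \<and>
     (\<forall>z. \<not> is_pole y z \<longrightarrow>
        (deriv y z) ^ 2 = chebyshev_T4 (y z) - (1 - 2 * (of_real l) ^ 2))"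

end

theory Submission
  imports Defs
begin

text \<open>Both \<open>y\<close> and \<open>a + 4 a \<kappa> / (P - 4/3 - 2 \<kappa>)\<close>, where \<open>a = y 0\<close> is a root of the quartic, satisfy
  \<open>(y')\<^sup>2 = 8 y\<^sup>4 - 8 y\<^sup>2 + 2 \<lambda>\<^sup>2\<close> with the same initial value, so they agree. Hence \<open>y\<close> has a pole
  where \<open>P = 4/3 + 2 \<kappa>\<close> and a zero where \<open>P = 4/3 - 2 \<kappa>\<close>. The cubic of \<open>P\<close> has the roots
  \<open>e1 = 4/3 > e2 = -2/3 + 2 \<lambda> > e3 = -2/3 - 2 \<lambda>\<close>, and \<open>(e1 - e2) (e1 - e3) = 4 \<kappa>\<^sup>2\<close>. The uniqueness
  argument also gives \<open>(P (z + \<Omega>) - e1) (P z - e1) = 4 \<kappa>\<^sup>2\<close>; putting \<open>z = - \<Omega>/2\<close> and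
  \<open>z = - \<Omega>/2 + \<Omega>'\<close> shows that \<open>P\<close> equals \<open>e1 \<plusminus> 2 \<kappa>\<close> at both points in question. The signs follow
  without counting zeros: \<open>P\<close> is real on the real axis, on the imaginary axis and on \<open>\<Omega>' + \<real>\<close>, so
  the sign of \<open>(P')\<^sup>2\<close> there and connectedness confine \<open>P\<close> to \<open>[e1, \<infinity>)\<close>, \<open>(-\<infinity>, e3]\<close> and
  \<open>[e3, e2]\<close> respectively.\<close>

subsection \<open>Lattice sums\<close>

locale period_lattice =
  fixes a b :: complex
  assumes ratio: "b / a \<notin> \<real>"
begin

abbreviation L :: "complex set" where "L \<equiv> lattice_gen a b"

lemma generators_nonzero: "a \<noteq> 0" "b \<noteq> 0"
  using ratio by auto

lemma zero_in_L: "0 \<in> L"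
  unfolding lattice_gen_def by (auto intro!: exI[of _ "0::int"])

lemma generators_in_L: "a \<in> L" "b \<in> L"
  unfolding lattice_gen_def
  by (auto intro: exI[of _ "1::int"] exI[of _ "0::int"])

lemma add_in_L: assumes "u \<in> L" "v \<in> L" shows "u + v \<in> L"
proof -
  obtain m n m' n' :: int where "u = of_int m * a + of_int n * b" "v = of_int m' * a + of_int n' * b"
    using assms unfolding lattice_gen_def by auto
  then have "u + v = of_int (m + m') * a + of_int (n + n') * b" by (simp add: algebra_simps)
  then show ?thesis unfolding lattice_gen_def by blast
qed

lemma uminus_in_L: assumes "u \<in> L" shows "- u \<in> L"
proof -
  obtain m n :: int where "u = of_int m * a + of_int n * b"
    using assms unfolding lattice_gen_def by auto
  then have "- u = of_int (- m) * a + of_int (- n) * b" by (simp add: algebra_simps)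
  then show ?thesis unfolding lattice_gen_def by blast
qed

lemma diff_in_L: "u \<in> L \<Longrightarrow> v \<in> L \<Longrightarrow> u - v \<in> L"
  using add_in_L[of u "- v"] uminus_in_L[of v] by simp

lemma add_L_iff: "v \<in> L \<Longrightarrow> u + v \<in> L \<longleftrightarrow> u \<in> L"
  using add_in_L[of u v] diff_in_L[of "u + v" v] by auto

lemma uminus_L_iff: "- u \<in> L \<longleftrightarrow> u \<in> L"
  using uminus_in_L[of u] uminus_in_L[of "- u"] by auto

lemma real_combination_zero:
  fixes s t :: real
  assumes "of_real s * a + of_real t * b = 0"
  shows "s = 0 \<and> t = 0"
proof -
  have "t = 0"
  proof (rule ccontr)
    assume "t \<noteq> 0"
    have "of_real t * b = - of_real s * a" using assms by (simp add: add_eq_0_iff)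
    then have "b / a = of_real (- s / t)"
      using \<open>t \<noteq> 0\<close> generators_nonzero by (simp add: field_simps)
    then show False using ratio Reals_of_real by metis
  qed
  then show ?thesis using assms generators_nonzero by simp
qed

text \<open>The coefficient 1/2 is no integer. \<open>P_periodic_generator\<close> evaluates
  \<open>P\<close> at half of a generator and relies on this point being no pole.\<close>

lemma half_generators_notin_L: "a / 2 \<notin> L" "b / 2 \<notin> L"
proof -
  show "a / 2 \<notin> L"
  proof
    assume "a / 2 \<in> L"
    then obtain m n :: int where mn: "a / 2 = of_int m * a + of_int n * b"
      unfolding lattice_gen_def by auto
    then have "of_real (real_of_int m - 1/2) * a + of_real (real_of_int n) * b = 0"
      by (simp add: algebra_simps)
    then have "real_of_int m = 1/2" by (blast dest: real_combination_zero intro: eq_iff_diff_eq_0[THEN iffD2])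
    then have "real_of_int (2 * m) = real_of_int 1" by simp
    then show False unfolding of_int_eq_iff by presburger
  qed
  show "b / 2 \<notin> L"
  proof
    assume "b / 2 \<in> L"
    then obtain m n :: int where mn: "b / 2 = of_int m * a + of_int n * b"
      unfolding lattice_gen_def by auto
    then have "of_real (real_of_int m) * a + of_real (real_of_int n - 1/2) * b = 0"
      by (simp add: algebra_simps)
    then have "real_of_int n = 1/2" by (blast dest: real_combination_zero intro: eq_iff_diff_eq_0[THEN iffD2])
    then have "real_of_int (2 * n) = real_of_int 1" by simp
    then show False unfolding of_int_eq_iff by presburger
  qed
qed

text \<open>Dividing by \<open>a\<close> reduces this to \<open>of_int m + of_int n * t\<close> with
  a nonreal \<open>t\<close>: its imaginary part bounds \<open>n\<close>, and the triangle
  inequality then bounds \<open>m\<close>.\<close>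

lemma lattice_norm_bound:
  obtains c :: real where "c > 0"
    and "\<And>m n::int. c * of_int (max \<bar>m\<bar> \<bar>n\<bar>) \<le> cmod (of_int m * a + of_int n * b)"
proof -
  define t where "t = b / a"
  have im: "Im t \<noteq> 0" using ratio unfolding t_def by (simp add: complex_is_Real_iff)
  \<comment> \<open>Large enough for both \<open>1 / \<bar>Im t\<bar>\<close>, the constant for
    \<open>n\<close>, and \<open>1 + cmod t / \<bar>Im t\<bar>\<close>, the constant for
    \<open>m\<close>.\<close>
  define K where "K = (1 + cmod t) / \<bar>Im t\<bar> + 1"
  have K: "K > 0" unfolding K_def using im by (intro add_nonneg_pos divide_nonneg_pos) auto
  have main: "of_int (max \<bar>m\<bar> \<bar>n\<bar>) \<le> K * cmod (of_int m + of_int n * t)" for m n :: int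
  proof -
    define w where "w = of_int m + of_int n * t"
    have "\<bar>Im w\<bar> = \<bar>real_of_int n\<bar> * \<bar>Im t\<bar>" unfolding w_def by (simp add: abs_mult)
    then have n: "\<bar>real_of_int n\<bar> * \<bar>Im t\<bar> \<le> cmod w" using abs_Im_le_cmod[of w] by linarith
    then have n': "\<bar>real_of_int n\<bar> \<le> cmod w / \<bar>Im t\<bar>" using im by (simp add: field_simps)
    have "cmod (of_int m) = cmod (w - of_int n * t)" unfolding w_def by simp
    also have "\<dots> \<le> cmod w + \<bar>real_of_int n\<bar> * cmod t"
      using norm_triangle_ineq4[of w "of_int n * t"] by (simp add: norm_mult)
    also have "\<dots> \<le> cmod w + cmod w / \<bar>Im t\<bar> * cmod t"
      using n' by (intro add_left_mono mult_right_mono) auto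
    finally have m: "\<bar>real_of_int m\<bar> \<le> cmod w + cmod w / \<bar>Im t\<bar> * cmod t" by simp
    have eq: "K * cmod w = cmod w / \<bar>Im t\<bar> + cmod w / \<bar>Im t\<bar> * cmod t + cmod w"
      unfolding K_def by (simp add: field_simps add_divide_distrib)
    have "0 \<le> cmod w / \<bar>Im t\<bar>" "0 \<le> cmod w / \<bar>Im t\<bar> * cmod t" "0 \<le> cmod w" by auto
    then have "\<bar>real_of_int m\<bar> \<le> K * cmod w" "\<bar>real_of_int n\<bar> \<le> K * cmod w"
      using m n' eq by linarith+
    then show ?thesis unfolding w_def by (simp add: max_def)
  qed
  show ?thesis
  proof (rule that[of "cmod a / K"])
    show "cmod a / K > 0" using K generators_nonzero by simp
    fix m n :: int
    have "cmod (of_int m * a + of_int n * b) = cmod a * cmod (of_int m + of_int n * t)"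
      unfolding t_def norm_mult[symmetric] using generators_nonzero
      by (simp add: algebra_simps)
    moreover have "cmod a / K * of_int (max \<bar>m\<bar> \<bar>n\<bar>)
        \<le> cmod a / K * (K * cmod (of_int m + of_int n * t))"
      using main[of m n] K by (intro mult_left_mono) auto
    ultimately show "cmod a / K * of_int (max \<bar>m\<bar> \<bar>n\<bar>) \<le> cmod (of_int m * a + of_int n * b)"
      using K by simp
  qed
qed

lemma lattice_point_lower_bound:
  obtains d :: real where "d > 0" and "\<And>w. w \<in> L - {0} \<Longrightarrow> d \<le> cmod w"
proof -
  obtain c where c: "c > 0"
    "\<And>m n::int. c * of_int (max \<bar>m\<bar> \<bar>n\<bar>) \<le> cmod (of_int m * a + of_int n * b)"
    using lattice_norm_bound by blast
  have "c \<le> cmod w" if "w \<in> L - {0}" for w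
  proof -
    from that have "w \<in> L" by simp
    then obtain m n :: int where w: "w = of_int m * a + of_int n * b"
      unfolding lattice_gen_def by auto
    then have "m \<noteq> 0 \<or> n \<noteq> 0" using that by auto
    then have "(1::int) \<le> max \<bar>m\<bar> \<bar>n\<bar>" by auto
    then have "(1::real) \<le> of_int (max \<bar>m\<bar> \<bar>n\<bar>)" by linarith
    then have "c * 1 \<le> c * of_int (max \<bar>m\<bar> \<bar>n\<bar>)" using c(1) by (intro mult_left_mono) auto
    then show ?thesis using c(2)[of m n] unfolding w by linarith
  qed
  then show ?thesis using that c(1) by blast
qed

text \<open>Differences of lattice points are lattice points, so \<open>d\<close> separates the
  points of any subset. The subsets that matter later are \<open>L\<close>, \<open>L - {0}\<close>
  and \<open>L - {z}\<close>.\<close>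

lemma closed_subset_L: assumes "S \<subseteq> L" shows "closed S"
proof -
  obtain d where d: "d > 0" "\<And>w. w \<in> L - {0} \<Longrightarrow> d \<le> cmod w"
    using lattice_point_lower_bound by blast
  show ?thesis
  proof (rule discrete_imp_closed[OF d(1)], intro ballI impI)
    fix x y assume "x \<in> S" "y \<in> S" "dist y x < d"
    then have "y - x \<in> L" "cmod (y - x) < d" using assms diff_in_L by (auto simp: dist_norm)
    then show "y = x" using d(2)[of "y - x"] by fastforce
  qed
qed

lemma countable_L: "countable L"
proof -
  have "L = (\<lambda>(m, n). of_int m * a + of_int n * b) ` (UNIV :: (int \<times> int) set)"
    unfolding lattice_gen_def by auto
  then show ?thesis by (metis countableI_type countable_image)
qed

lemma connected_complement_L: "connected (- L)"
  using path_connected_complement_countable[OF _ countable_L] by (simp add: path_connected_imp_connected)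

lemma open_complement_L: "open (- L)"
  using closed_subset_L[of L] by (simp add: open_Compl)

end

text \<open>The exponent is half of -3: two such factors, one for each coordinate, together majorise
  the inverse cube of the norm of a lattice point.\<close>

lemma summable_int_powr: "(\<lambda>m::int. (1 + \<bar>real_of_int m\<bar>) powr (-3/2)) summable_on UNIV"
proof -
  have "summable (\<lambda>n. real n powr (-3/2))" using summable_real_powr_iff[of "-3/2"] by simp
  then have "summable (\<lambda>n. real (Suc n) powr (-3/2))" by (subst summable_Suc_iff)
  then have s: "(\<lambda>n. real (Suc n) powr (-3/2)) summable_on UNIV"
    by (intro norm_summable_imp_summable_on) simp
  have "(\<lambda>m::int. (1 + \<bar>real_of_int m\<bar>) powr (-3/2)) summable_on range int"
    using s by (subst summable_on_reindex) (auto simp: o_def add.commute)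
  moreover have "(\<lambda>m::int. (1 + \<bar>real_of_int m\<bar>) powr (-3/2)) summable_on range (\<lambda>n. - int n)"
    using s by (subst summable_on_reindex) (auto simp: o_def add.commute inj_def)
  ultimately have "(\<lambda>m::int. (1 + \<bar>real_of_int m\<bar>) powr (-3/2))
      summable_on (range int \<union> range (\<lambda>n. - int n))"
    by (rule summable_on_union)
  moreover have "range int \<union> range (\<lambda>n. - int n) = UNIV"
  proof -
    have "m \<in> range int \<union> range (\<lambda>n. - int n)" for m
      by (cases m rule: int_cases2) auto
    then show ?thesis by blast
  qed
  ultimately show ?thesis by simp
qed

context period_lattice
begin

text \<open>Comparison with the product series over pairs of integers, which converges because each
  factor does.\<close>

lemma summable_lattice_cube: "(\<lambda>w. 1 / cmod w ^ 3) summable_on (L - {0})"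
proof -
  obtain c where c: "c > 0"
    "\<And>m n::int. c * of_int (max \<bar>m\<bar> \<bar>n\<bar>) \<le> cmod (of_int m * a + of_int n * b)"
    using lattice_norm_bound by blast
  define f where "f = (\<lambda>m::int. (1 + \<bar>real_of_int m\<bar>) powr (-3/2))"
  have f: "f summable_on UNIV" unfolding f_def by (rule summable_int_powr)
  have f0: "f m \<ge> 0" for m unfolding f_def by simp
  have prod: "(\<lambda>(m, n). f m * f n) summable_on (UNIV \<times> UNIV)"
  proof (rule summable_on_SigmaI)
    show "((\<lambda>n. case (m, n) of (m, n) \<Rightarrow> f m * f n) has_sum f m * infsum f UNIV) UNIV" for m
      using has_sum_cmult_right[OF has_sum_infsum[OF f], of "f m"] by simp
    show "(\<lambda>m. f m * infsum f UNIV) summable_on UNIV"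
      by (rule summable_on_cmult_left) (rule f)
  qed (use f0 in auto)
  define g where "g = (\<lambda>(m, n). of_int m * a + of_int n * b)"
  define I where "I = (UNIV :: (int \<times> int) set) - {(0, 0)}"
  have inj: "inj_on g I"
  proof (rule inj_onI, clarify)
    fix m n m' n' :: int assume "g (m, n) = g (m', n')"
    then have "of_real (real_of_int (m - m')) * a + of_real (real_of_int (n - n')) * b = 0"
      unfolding g_def by (simp add: algebra_simps)
    then show "m = m' \<and> n = n'" using real_combination_zero by fastforce
  qed
  have img: "L - {0} = g ` I"
  proof -
    have "g p = 0 \<Longrightarrow> p = (0, 0)" for p
    proof -
      obtain m n where p: "p = (m, n)" by (cases p)
      show "g p = 0 \<Longrightarrow> p = (0, 0)"
        using real_combination_zero[of "real_of_int m" "real_of_int n"] p unfolding g_def by simp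
    qed
    moreover have "L = range g" unfolding g_def lattice_gen_def by auto
    ultimately show ?thesis unfolding I_def by (auto simp: g_def)
  qed
  have bound: "1 / cmod (g p) ^ 3 \<le> 8 / c ^ 3 * (case p of (m, n) \<Rightarrow> f m * f n)" if "p \<in> I" for p
  proof -
    obtain m n where p: "p = (m, n)" by (cases p)
    define M where "M = real_of_int (max \<bar>m\<bar> \<bar>n\<bar>)"
    have "(1::int) \<le> max \<bar>m\<bar> \<bar>n\<bar>" using that p unfolding I_def by auto
    then have M1: "1 \<le> M" unfolding M_def by linarith
    \<comment> \<open>Since \<open>M\<close> is at least 1, it absorbs the shift by 1; the price is
      the factor 8 in the bound.\<close>
    have mn: "1 + \<bar>real_of_int m\<bar> \<le> 2 * M" "1 + \<bar>real_of_int n\<bar> \<le> 2 * M"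
      using M1 unfolding M_def by (auto simp: max_def split: if_splits)
    have "(2 * M) powr (-3/2) \<le> f m" "(2 * M) powr (-3/2) \<le> f n"
      unfolding f_def using mn by (auto intro!: powr_mono2')
    then have "(2 * M) powr (-3/2) * (2 * M) powr (-3/2) \<le> f m * f n"
      using f0 by (intro mult_mono) auto
    moreover have "(2 * M) powr (-3/2) * (2 * M) powr (-3/2) = 1 / (2 * M) ^ 3"
    proof -
      have "(2 * M) powr (-3/2) * (2 * M) powr (-3/2) = (2 * M) powr (- 3)"
        by (simp flip: powr_add)
      also have "\<dots> = 1 / (2 * M) powr (real 3)" by (simp add: powr_minus_divide)
      also have "(2 * M) powr (real 3) = (2 * M) ^ 3" using M1 by (subst powr_realpow) auto
      finally show ?thesis .
    qed
    ultimately have 1: "1 / (2 * M) ^ 3 \<le> f m * f n" by simp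
    have "c * M \<le> cmod (g p)" using c(2)[of m n] unfolding g_def p M_def by simp
    moreover have "0 < c * M" using c(1) M1 by simp
    moreover have "0 < cmod (g p)" using calculation by (rule order.strict_trans2[rotated])
    moreover have "(c * M) ^ 3 \<le> cmod (g p) ^ 3"
      by (rule power_mono) (use calculation in auto)
    ultimately have "1 / cmod (g p) ^ 3 \<le> 1 / (c * M) ^ 3"
      using c(1) M1 by (intro divide_left_mono mult_pos_pos zero_less_power) auto
    also have "\<dots> = 8 / c ^ 3 * (1 / (2 * M) ^ 3)" by (simp add: power_mult_distrib field_simps)
    also have "\<dots> \<le> 8 / c ^ 3 * (f m * f n)" using 1 c(1) by (intro mult_left_mono) auto
    finally show ?thesis by (simp add: p)
  qed
  have "(\<lambda>p. 8 / c ^ 3 * (case p of (m, n) \<Rightarrow> f m * f n)) summable_on I"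
    by (rule summable_on_cmult_right, rule summable_on_subset[OF prod]) auto
  then have "(\<lambda>p. 1 / cmod (g p) ^ 3) summable_on I"
    by (rule summable_on_comparison_test) (use bound in auto)
  then show ?thesis unfolding img by (subst summable_on_reindex[OF inj]) (simp add: o_def)
qed

end

subsection \<open>The Weierstrass function\<close>

text \<open>The series of \<open>q\<close> is differentiated through its finite partial sums. The
  term \<open>1 / w ^ 2\<close> survives only for \<open>n = 0\<close>.\<close>

lemma higher_deriv_pole_sum:
  fixes S F :: "complex set"
  assumes "open S" "finite F" "F \<inter> S = {}" "z \<in> S"
  shows "(deriv ^^ n) (\<lambda>z. \<Sum>w\<in>F. 1 / (z - w) ^ 2 - 1 / w ^ 2) z =
    (\<Sum>w\<in>F. (- 1) ^ n * fact (n + 1) / (z - w) ^ (n + 2) - (if n = 0 then 1 / w ^ 2 else 0))"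
  using assms(4)
proof (induction n arbitrary: z)
  case (Suc n)
  have term_deriv: "((\<lambda>z. (- 1) ^ n * fact (n + 1) / (z - w) ^ (n + 2) - (if n = 0 then 1 / w ^ 2 else 0))
      has_field_derivative (- 1) ^ Suc n * fact (Suc n + 1) / (z - w) ^ (Suc n + 2)) (at z)"
    if "w \<in> F" for w
  proof -
    have nz: "z - w \<noteq> 0" using that Suc.prems assms(3) by auto
    define C :: complex where "C = (- 1) ^ n * fact (n + 1)"
    have "((\<lambda>z. (z - w) ^ Suc (n + 1)) has_field_derivative
        (1 + of_nat (n + 1)) * (1 * (z - w) ^ (n + 1))) (at z)"
      by (intro DERIV_power_Suc) (auto intro!: derivative_eq_intros)
    then have "((\<lambda>z. C / (z - w) ^ (n + 2) - (if n = 0 then 1 / w ^ 2 else 0)) has_field_derivative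
        (0 * (z - w) ^ (n + 2) - C * ((1 + of_nat (n + 1)) * (1 * (z - w) ^ (n + 1)))) /
          ((z - w) ^ (n + 2) * (z - w) ^ (n + 2)) - 0) (at z)"
      using nz by (intro DERIV_diff DERIV_divide DERIV_const) auto
    also have "(0 * (z - w) ^ (n + 2) - C * ((1 + of_nat (n + 1)) * (1 * (z - w) ^ (n + 1)))) /
          ((z - w) ^ (n + 2) * (z - w) ^ (n + 2)) - 0 = - (C * (2 + of_nat n)) / (z - w) ^ (n + 3)"
      using nz by (simp add: divide_simps power_add power2_eq_square power3_eq_cube)
    also have "- (C * (2 + of_nat n)) = (- 1) ^ Suc n * fact (Suc n + 1)"
      unfolding C_def by (simp add: algebra_simps)
    finally have "((\<lambda>z. C / (z - w) ^ (n + 2) - (if n = 0 then 1 / w ^ 2 else 0)) has_field_derivative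
        (- 1) ^ Suc n * fact (Suc n + 1) / (z - w) ^ (n + 3)) (at z)" .
    moreover have "Suc n + 2 = n + 3" by simp
    ultimately show ?thesis unfolding C_def by (simp only:)
  qed
  have "(deriv ^^ Suc n) (\<lambda>z. \<Sum>w\<in>F. 1 / (z - w) ^ 2 - 1 / w ^ 2) z =
      deriv ((deriv ^^ n) (\<lambda>z. \<Sum>w\<in>F. 1 / (z - w) ^ 2 - 1 / w ^ 2)) z"
    by simp
  also have "\<dots> = deriv (\<lambda>z. \<Sum>w\<in>F. (- 1) ^ n * fact (n + 1) / (z - w) ^ (n + 2) -
      (if n = 0 then 1 / w ^ 2 else 0)) z"
    by (rule deriv_cong_ev[OF eventually_mono[OF eventually_nhds_in_open[OF assms(1) Suc.prems] Suc.IH] refl])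
  also have "\<dots> = (\<Sum>w\<in>F. (- 1) ^ Suc n * fact (Suc n + 1) / (z - w) ^ (Suc n + 2))"
    by (rule DERIV_imp_deriv, rule DERIV_sum) (rule term_deriv)
  finally show ?case by simp
qed (simp add: power2_eq_square)

section \<open>Convergence and derivatives of the regular part of the Weierstrass function\<close>

context period_lattice
begin

text \<open>\<open>P\<close> without its principal part at 0. Only the nonzero lattice points are
  singular, so the Taylor expansion of \<open>q\<close> at 0 gives the Laurent expansion of
  \<open>P\<close>.\<close>

definition q :: "complex \<Rightarrow> complex" where
  "q z = (\<Sum>\<^sub>\<infinity>w\<in>L - {0}. (1 / (z - w) ^ 2 - 1 / w ^ 2))"

abbreviation P :: "complex \<Rightarrow> complex" where "P \<equiv> weierstrass_p L"

lemma P_eq: "z \<notin> L \<Longrightarrow> P z = 1 / z ^ 2 + q z"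
  unfolding weierstrass_p_def q_def by simp

lemma P_on_L: "z \<in> L \<Longrightarrow> P z = 0"
  unfolding weierstrass_p_def by simp

lemma open_complement_L0: "open (- (L - {0}))"
  by (rule open_Compl, rule closed_subset_L) auto

text \<open>The two fractions combine to \<open>z * (2 * w - z) / ((z - w) ^ 2 * w ^ 2)\<close>,
  which is of order \<open>1 / cmod w ^ 3\<close> uniformly in \<open>z\<close> near
  \<open>z0\<close>, so the M-test applies.\<close>

lemma q_uniform_limit:
  assumes "z0 \<in> - (L - {0})"
  obtains r where "r > 0" "ball z0 r \<subseteq> - (L - {0})"
    "uniform_limit (ball z0 r) (\<lambda>F z. \<Sum>w\<in>F. 1 / (z - w) ^ 2 - 1 / w ^ 2) q
       (finite_subsets_at_top (L - {0}))"
proof -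
  obtain e where e: "e > 0" "ball z0 e \<subseteq> - (L - {0})"
    using assms open_complement_L0 open_contains_ball by blast
  obtain d where d: "d > 0" "\<And>w. w \<in> L - {0} \<Longrightarrow> d \<le> cmod w"
    using lattice_point_lower_bound by blast
  \<comment> \<open>Half of \<open>e\<close>, so that every \<open>z\<close> in the small ball still
    has distance at least \<open>r\<close> from every nonzero lattice point.\<close>
  define r where "r = e / 2"
  have r: "r > 0" using e unfolding r_def by simp
  define R where "R = cmod z0 + r"
  \<comment> \<open>The constant in \<open>cmod w \<le> K * cmod (z - w)\<close>: the part
    \<open>R / r\<close> absorbs \<open>cmod z \<le> R\<close>, because
    \<open>r \<le> cmod (z - w)\<close>.\<close>
  define K where "K = 1 + R / r"
  have R: "R > 0" unfolding R_def using r by (simp add: add_nonneg_pos)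
  have K: "K > 0" unfolding K_def using r R by (simp add: add_pos_pos)
  have bound: "norm (1 / (z - w) ^ 2 - 1 / w ^ 2) \<le> R * (2 + R / d) * K ^ 2 * (1 / cmod w ^ 3)"
    if w: "w \<in> L - {0}" and z: "z \<in> ball z0 r" for w z
  proof -
    have "e \<le> cmod (z0 - w)" using e(2) w by (force simp: dist_norm)
    moreover have "cmod (z0 - z) < r" using z by (simp add: dist_norm)
    moreover have "cmod (z0 - w) \<le> cmod (z0 - z) + cmod (z - w)"
      using norm_triangle_ineq[of "z0 - z" "z - w"] by simp
    ultimately have zw: "r \<le> cmod (z - w)" unfolding r_def by simp
    have zR: "cmod z \<le> R"
      using norm_triangle_ineq4[of z0 "z0 - z"] \<open>cmod (z0 - z) < r\<close> unfolding R_def by simp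
    have w0: "cmod w > 0" using w by simp
    have "cmod w \<le> cmod (z - w) + cmod z"
      using norm_triangle_ineq4[of z "z - w"] by simp
    also have "\<dots> \<le> cmod (z - w) + cmod (z - w) / r * R"
    proof -
      have "1 * R \<le> cmod (z - w) / r * R" using zw r R by (intro mult_right_mono) auto
      then show ?thesis using zR by simp
    qed
    also have "\<dots> = K * cmod (z - w)" unfolding K_def by (simp add: field_simps)
    finally have wK: "cmod w \<le> K * cmod (z - w)" .
    have nz: "z - w \<noteq> 0" "w \<noteq> 0" using zw r w by auto
    have "1 / (z - w) ^ 2 - 1 / w ^ 2 = z * (2 * w - z) / ((z - w) ^ 2 * w ^ 2)"
      by (subst diff_frac_eq) (use nz in simp, use nz in simp, simp add: power2_eq_square algebra_simps)
    then have "norm (1 / (z - w) ^ 2 - 1 / w ^ 2)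
        = cmod z * cmod (2 * w - z) / (cmod (z - w) ^ 2 * cmod w ^ 2)"
      by (simp add: norm_mult norm_divide norm_power)
    also have "\<dots> \<le> R * ((2 + R / d) * cmod w) / ((cmod w / K) ^ 2 * cmod w ^ 2)"
    proof (intro frac_le mult_mono mult_right_mono power_mono)
      have "cmod (2 * w - z) \<le> 2 * cmod w + R"
        using norm_triangle_ineq4[of "2 * w" z] zR by (simp add: norm_mult)
      also have "R \<le> R / d * cmod w" using d w R by (simp add: field_simps)
      finally show "cmod (2 * w - z) \<le> (2 + R / d) * cmod w" by (simp add: algebra_simps)
      show "cmod w / K \<le> cmod (z - w)" using wK K by (simp add: field_simps)
    qed (use zR R K w0 d in auto)
    also have "\<dots> = R * (2 + R / d) * K ^ 2 * (1 / cmod w ^ 3)"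
      using K w0 by (simp add: field_simps power2_eq_square power3_eq_cube)
    finally show ?thesis .
  qed
  have "uniform_limit (ball z0 r) (\<lambda>F z. \<Sum>w\<in>F. 1 / (z - w) ^ 2 - 1 / w ^ 2)
      (\<lambda>z. \<Sum>\<^sub>\<infinity>w\<in>L - {0}. 1 / (z - w) ^ 2 - 1 / w ^ 2) (finite_subsets_at_top (L - {0}))"
    using bound summable_on_cmult_right[OF summable_lattice_cube]
    by (rule Weierstrass_m_test_general)
  moreover have "ball z0 r \<subseteq> - (L - {0})"
    using subset_ball[of r e z0] e r unfolding r_def by fastforce
  ultimately show ?thesis using that r unfolding q_def[abs_def] by blast
qed

lemma partial_sum_holomorphic:
  assumes "finite F" "F \<subseteq> L - {0}"
  shows "(\<lambda>z. \<Sum>w\<in>F. 1 / (z - w) ^ 2 - 1 / w ^ 2) holomorphic_on - (L - {0})"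
  by (intro holomorphic_intros) (use assms in auto)

lemma eventually_finite_subsets:
  "eventually (\<lambda>F. finite F \<and> F \<subseteq> A) (finite_subsets_at_top A)"
  unfolding eventually_finite_subsets_at_top by (auto intro!: exI[of _ "{}"])

lemma q_holomorphic: "q holomorphic_on - (L - {0})"
proof -
  have "q field_differentiable (at z0)" if z0: "z0 \<in> - (L - {0})" for z0
  proof -
    obtain r where r: "r > 0" "ball z0 r \<subseteq> - (L - {0})"
      "uniform_limit (ball z0 r) (\<lambda>F z. \<Sum>w\<in>F. 1 / (z - w) ^ 2 - 1 / w ^ 2) q
       (finite_subsets_at_top (L - {0}))"
      using q_uniform_limit[OF z0] by blast
    have sub: "cball z0 (r / 2) \<subseteq> ball z0 r" "ball z0 (r / 2) \<subseteq> ball z0 r" using r(1) by auto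
    have "q holomorphic_on ball z0 (r / 2)"
    proof (rule holomorphic_uniform_limit)
      show "uniform_limit (cball z0 (r / 2)) (\<lambda>F z. \<Sum>w\<in>F. 1 / (z - w) ^ 2 - 1 / w ^ 2) q
         (finite_subsets_at_top (L - {0}))"
        by (rule uniform_limit_on_subset[OF r(3) sub(1)])
      show "\<forall>\<^sub>F F in finite_subsets_at_top (L - {0}).
        continuous_on (cball z0 (r / 2)) (\<lambda>z. \<Sum>w\<in>F. 1 / (z - w) ^ 2 - 1 / w ^ 2) \<and>
        (\<lambda>z. \<Sum>w\<in>F. 1 / (z - w) ^ 2 - 1 / w ^ 2) holomorphic_on ball z0 (r / 2)"
        using eventually_finite_subsets
      proof eventually_elim
        case (elim F)
        then have "(\<lambda>z. \<Sum>w\<in>F. 1 / (z - w) ^ 2 - 1 / w ^ 2) holomorphic_on ball z0 r"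
          using holomorphic_on_subset[OF partial_sum_holomorphic r(2)] by simp
        then show ?case
          using holomorphic_on_subset[OF _ sub(2)]
            holomorphic_on_imp_continuous_on[OF holomorphic_on_subset[OF _ sub(1)]] by simp
      qed
    qed auto
    then show ?thesis
      using r(1) by (auto simp: holomorphic_on_open field_differentiable_def)
  qed
  then show ?thesis by (simp add: holomorphic_on_def field_differentiable_at_within)
qed

text \<open>Derivatives pass to the locally uniform limit. From \<open>n = 1\<close> on the
  convergence-producing terms \<open>1 / w ^ 2\<close> are gone.\<close>

lemma q_higher_deriv_has_sum:
  assumes "z \<in> - (L - {0})" "n \<ge> 1"
  shows "((\<lambda>w. (- 1) ^ n * fact (n + 1) / (z - w) ^ (n + 2)) has_sum (deriv ^^ n) q z) (L - {0})"
proof -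
  obtain r where r: "r > 0" "ball z r \<subseteq> - (L - {0})"
      "uniform_limit (ball z r) (\<lambda>F z. \<Sum>w\<in>F. 1 / (z - w) ^ 2 - 1 / w ^ 2) q
       (finite_subsets_at_top (L - {0}))"
    using q_uniform_limit[OF assms(1)] by blast
  have "((\<lambda>F. (deriv ^^ n) (\<lambda>z. \<Sum>w\<in>F. 1 / (z - w) ^ 2 - 1 / w ^ 2) z) \<longlongrightarrow> (deriv ^^ n) q z)
      (finite_subsets_at_top (L - {0}))"
  proof (rule higher_deriv_complex_uniform_limit[OF r(3)])
    show "\<forall>\<^sub>F F in finite_subsets_at_top (L - {0}).
        (\<lambda>z. \<Sum>w\<in>F. 1 / (z - w) ^ 2 - 1 / w ^ 2) holomorphic_on ball z r"
      using eventually_finite_subsets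
    proof eventually_elim
      case (elim F)
      then show ?case
        using holomorphic_on_subset[OF partial_sum_holomorphic r(2)] by simp
    qed
  qed (use r(1) in auto)
  moreover have "\<forall>\<^sub>F F in finite_subsets_at_top (L - {0}).
      (deriv ^^ n) (\<lambda>z. \<Sum>w\<in>F. 1 / (z - w) ^ 2 - 1 / w ^ 2) z =
      (\<Sum>w\<in>F. (- 1) ^ n * fact (n + 1) / (z - w) ^ (n + 2))"
    using eventually_finite_subsets
  proof eventually_elim
    case (elim F)
    then have "F \<inter> - (L - {0}) = {}" by blast
    then show ?case
      using higher_deriv_pole_sum[OF open_complement_L0 _ _ assms(1), of F n] elim assms(2) by simp
  qed
  ultimately show ?thesis
    unfolding has_sum_def by (blast intro: Lim_transform_eventually)
qed

section \<open>Holomorphy, periodicity and poles of \<open>P\<close>\<close>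

lemma P_holomorphic: "P holomorphic_on - L"
proof -
  have "q holomorphic_on - L" by (rule holomorphic_on_subset[OF q_holomorphic]) auto
  moreover have "z \<noteq> 0" if "z \<in> - L" for z using that zero_in_L by auto
  ultimately have "(\<lambda>z. 1 / z ^ 2 + q z) holomorphic_on - L"
    by (intro holomorphic_intros) auto
  then show ?thesis by (rule holomorphic_transform) (use P_eq in auto)
qed

lemma P_has_deriv: "z \<notin> L \<Longrightarrow> (P has_field_derivative deriv P z) (at z)"
  using holomorphic_derivI[OF P_holomorphic open_complement_L, of z] by simp

lemma deriv_P_holomorphic: "deriv P holomorphic_on - L"
  by (rule holomorphic_deriv[OF P_holomorphic open_complement_L])

lemma deriv_P_eq:
  assumes "z \<notin> L" shows "deriv P z = - 2 / z ^ 3 + deriv q z"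
proof -
  have z: "z \<noteq> 0" using assms zero_in_L by auto
  have "(q has_field_derivative deriv q z) (at z)"
    using holomorphic_derivI[OF q_holomorphic open_complement_L0, of z] assms by simp
  then have "((\<lambda>z. 1 / z ^ 2 + q z) has_field_derivative - 2 / z ^ 3 + deriv q z) (at z)"
    using z by (auto intro!: derivative_eq_intros simp: field_simps power2_eq_square power3_eq_cube)
  then have "(P has_field_derivative - 2 / z ^ 3 + deriv q z) (at z)"
    by (rule has_field_derivative_transform_within_open[OF _ open_complement_L]) (use assms P_eq in auto)
  then show ?thesis by (rule DERIV_imp_deriv)
qed

text \<open>The derivative of the principal part supplies the term \<open>w = 0\<close>. With the
  sum over all of \<open>L\<close>, periodicity in \<open>deriv_P_periodic\<close> is a mere
  reindexing.\<close>

lemma deriv_P_has_sum: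
  assumes "z \<notin> L" shows "((\<lambda>w. - 2 / (z - w) ^ 3) has_sum deriv P z) L"
proof -
  have "((\<lambda>w. - 2 / (z - w) ^ 3) has_sum deriv q z) (L - {0})"
    using q_higher_deriv_has_sum[of z 1] assms by (simp add: numeral_3_eq_3)
  then have "((\<lambda>w. - 2 / (z - w) ^ 3) has_sum - 2 / (z - 0) ^ 3 + deriv q z) (insert 0 (L - {0}))"
    by (intro has_sum_insert) auto
  then show ?thesis using zero_in_L deriv_P_eq[OF assms] by (simp add: insert_absorb)
qed

lemma deriv_P_periodic:
  assumes "z \<notin> L" "v \<in> L" shows "deriv P (z + v) = deriv P z"
proof -
  have "((\<lambda>w. - 2 / (z - w) ^ 3) has_sum deriv P (z + v)) L \<longleftrightarrow>
      ((\<lambda>w. - 2 / (z + v - w) ^ 3) has_sum deriv P (z + v)) L"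
    by (rule has_sum_reindex_bij_witness[of _ "\<lambda>w. w - v" "\<lambda>w. w + v"])
      (use assms add_in_L diff_in_L in auto)
  then have "((\<lambda>w. - 2 / (z - w) ^ 3) has_sum deriv P (z + v)) L"
    using deriv_P_has_sum[of "z + v"] add_L_iff[of v z] assms by simp
  then show ?thesis using deriv_P_has_sum[OF assms(1)] has_sum_unique by blast
qed

lemma q_even: "q (- z) = q z"
  unfolding q_def
  by (rule infsum_reindex_bij_witness[of _ uminus uminus])
    (auto simp: uminus_L_iff power2_eq_square algebra_simps)

lemma P_even: "P (- z) = P z"
  using P_eq[of z] P_eq[of "- z"] P_on_L[of z] P_on_L[of "- z"] uminus_L_iff[of z] q_even
  by (cases "z \<in> L") auto

text \<open>Since \<open>deriv P\<close> is periodic, \<open>P (z + v) - P z\<close> is constant on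
  the connected complement of \<open>L\<close>; at \<open>- (v / 2)\<close> evenness makes it
  0.\<close>

lemma P_periodic_generator:
  assumes v: "v \<in> L" "v / 2 \<notin> L" shows "P (z + v) = P z"
proof (cases "z \<in> L")
  case True
  then show ?thesis using P_on_L add_L_iff[OF v(1), of z] by simp
next
  case False
  have "\<exists>c. \<forall>z\<in>- L. P (z + v) - P z = c"
  proof (rule DERIV_zero_connected_constant[OF connected_complement_L open_complement_L finite.emptyI])
    have d: "((\<lambda>z. P (z + v) - P z) has_field_derivative 0) (at z)" if "z \<notin> L" for z
    proof -
      have "((\<lambda>z. P (z + v) - P z) has_field_derivative deriv P (z + v) * (1 + 0) - deriv P z) (at z)"
        using that add_L_iff[OF v(1), of z]
        by (intro DERIV_diff DERIV_chain2[of P] DERIV_add P_has_deriv DERIV_ident DERIV_const) auto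
      then show ?thesis using deriv_P_periodic[OF that v(1)] by simp
    qed
    then show "\<forall>z\<in>- L - {}. ((\<lambda>z. P (z + v) - P z) has_field_derivative 0) (at z)" by auto
    show "continuous_on (- L) (\<lambda>z. P (z + v) - P z)"
      by (rule DERIV_continuous_on, rule has_field_derivative_at_within) (use d in auto)
  qed metis
  then obtain c where c: "\<And>z. z \<notin> L \<Longrightarrow> P (z + v) - P z = c" by auto
  have "c = P (- (v / 2) + v) - P (- (v / 2))" using c[of "- (v / 2)"] v(2) uminus_L_iff by simp
  also have "\<dots> = P (v / 2) - P (v / 2)" unfolding P_even by simp
  finally show ?thesis using c[OF False] by simp
qed

text \<open>A general lattice vector may have its half in \<open>L\<close>, so the two generators
  come first and their integer multiples follow by induction.\<close>

lemma P_periodic: assumes "v \<in> L" shows "P (z + v) = P z"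
proof -
  have nat: "P (z + of_nat n * g) = P z" if "\<And>z. P (z + g) = P z" for n g z
  proof (induction n)
    case (Suc n)
    have "P (z + of_nat (Suc n) * g) = P (z + of_nat n * g + g)" by (simp add: algebra_simps)
    then show ?case using that Suc.IH by simp
  qed simp
  have int: "P (z + of_int m * g) = P z" if "\<And>z. P (z + g) = P z" for m g z
  proof (cases m rule: int_cases2)
    case (nonneg n)
    then show ?thesis using nat[OF that] by simp
  next
    case (nonpos n)
    then show ?thesis using nat[OF that, of "z - of_nat n * g" n] by simp
  qed
  obtain m n :: int where v: "v = of_int m * a + of_int n * b"
    using assms unfolding lattice_gen_def by auto
  have "P (z + of_int m * a + of_int n * b) = P (z + of_int m * a)"
    by (rule int, rule P_periodic_generator) (use generators_in_L half_generators_notin_L in auto)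
  also have "\<dots> = P z"
    by (rule int, rule P_periodic_generator) (use generators_in_L half_generators_notin_L in auto)
  finally show ?thesis unfolding v by (simp add: add.assoc)
qed

lemma q_near_0: obtains r where "r > 0" "q holomorphic_on ball 0 r" "ball 0 r \<inter> L = {0}"
proof -
  have "(0::complex) \<in> - (L - {0})" by simp
  then obtain r where r: "r > 0" "ball 0 r \<subseteq> - (L - {0})"
    using open_complement_L0 open_contains_ball by meson
  then have "q holomorphic_on ball 0 r" "ball 0 r \<inter> L = {0}"
    using q_holomorphic holomorphic_on_subset zero_in_L by (blast, auto)
  then show ?thesis using that r(1) by blast
qed

lemma filterlim_P_0: "filterlim P at_infinity (at 0)"
proof -
  obtain r where r: "r > 0" "q holomorphic_on ball 0 r" "ball 0 r \<inter> L = {0}"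
    using q_near_0 by blast
  have "isCont q 0"
    using r(1,2) by (meson centre_in_ball continuous_on_eq_continuous_at holomorphic_on_imp_continuous_on open_ball)
  then have "q \<midarrow>0\<rightarrow> q 0" by (simp add: isCont_def)
  moreover have "filterlim (\<lambda>z::complex. 1 / z ^ 2) at_infinity (at 0)"
    by (intro filterlim_divide_at_infinity[of _ 1] tendsto_const filterlim_atI)
      (auto intro!: tendsto_eq_intros simp: eventually_at_filter)
  ultimately have "filterlim (\<lambda>z. q z + 1 / z ^ 2) at_infinity (at 0)"
    by (rule tendsto_add_filterlim_at_infinity)
  moreover have "eventually (\<lambda>z. q z + 1 / z ^ 2 = P z) (at 0)"
    unfolding eventually_at
  proof (intro exI[of _ r] conjI ballI impI)
    fix z :: complex assume "z \<noteq> 0 \<and> dist z 0 < r"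
    then have "z \<in> ball 0 r" "z \<noteq> 0" by auto
    then have "z \<notin> L" using r(3) by blast
    then show "q z + 1 / z ^ 2 = P z" using P_eq by simp
  qed (rule r(1))
  ultimately show ?thesis by (subst (asm) filterlim_cong[OF refl refl])
qed

lemma is_pole_P: assumes "v \<in> L" shows "is_pole P v"
proof -
  have "filterlim (\<lambda>z. P (z + v)) at_infinity (at 0)"
    using filterlim_P_0 P_periodic[OF assms] by simp
  then show ?thesis
    unfolding is_pole_def by (subst at_to_0) (simp add: filterlim_filtermap)
qed

text \<open>A period outside \<open>L\<close> would carry the pole at 0 to a point of continuity. In
  \<open>theorem8\<close> this recovers the lattice from \<open>P\<close>.\<close>

lemma periods_P: "periods P = L"
proof
  show "L \<subseteq> periods P" unfolding periods_def using P_periodic by auto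
  show "periods P \<subseteq> L"
  proof
    fix v assume "v \<in> periods P"
    then have per: "P (z + v) = P z" for z unfolding periods_def by auto
    show "v \<in> L"
    proof (rule ccontr)
      assume "v \<notin> L"
      then have "isCont P v" using P_has_deriv DERIV_isCont by blast
      then have "P \<midarrow>v\<rightarrow> P v" by (simp add: isCont_def)
      then have "(\<lambda>z. P (z + v)) \<midarrow>0\<rightarrow> P v"
        by (subst (asm) at_to_0) (simp add: filterlim_filtermap)
      then have "P \<midarrow>0\<rightarrow> P v" unfolding per by simp
      then show False
        using filterlim_P_0 not_tendsto_and_filterlim_at_infinity[of "at 0" P] by auto
    qed
  qed
qed

end

subsection \<open>The differential equation of the Weierstrass function\<close>

text \<open>Dropping the first \<open>n\<close> terms and dividing by \<open>z ^ n\<close> leaves a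
  power series that converges on the same ball.\<close>

lemma holomorphic_Taylor_split:
  assumes "f holomorphic_on ball 0 r"
  obtains g where "g holomorphic_on ball 0 r"
    "\<And>z. z \<in> ball 0 r \<Longrightarrow> f z = (\<Sum>k<n. (deriv ^^ k) f 0 / fact k * z ^ k) + z ^ n * g z"
proof -
  define c where "c k = (deriv ^^ k) f 0 / fact k" for k
  define g where "g z = (\<Sum>k. c (k + n) * z ^ k)" for z
  have f: "(\<lambda>k. c k * z ^ k) sums f z" if "z \<in> ball 0 r" for z
    using holomorphic_power_series[OF assms that] unfolding c_def by simp
  have g: "(\<lambda>k. c (k + n) * z ^ k) sums g z" if "z \<in> ball 0 r" for z
  proof (cases "z = 0")
    case True
    then show ?thesis unfolding g_def by simp
  next
    case False
    have "summable (\<lambda>k. c (k + n) * z ^ (k + n))"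
      using f[OF that] sums_summable summable_ignore_initial_segment by blast
    then have "summable (\<lambda>k. c (k + n) * z ^ (k + n) / z ^ n)" by (rule summable_divide)
    then have "summable (\<lambda>k. c (k + n) * z ^ k)" using False by (simp add: power_add)
    then show ?thesis unfolding g_def by (rule summable_sums)
  qed
  show ?thesis
  proof (rule that[of g])
    show "g holomorphic_on ball 0 r"
      by (rule power_series_holomorphic[of 0 r "\<lambda>k. c (k + n)"]) (use g in simp)
    fix z :: complex assume z: "z \<in> ball 0 r"
    have "(\<lambda>k. z ^ n * (c (k + n) * z ^ k)) sums (z ^ n * g z)" by (rule sums_mult[OF g[OF z]])
    moreover have "(\<lambda>k. z ^ n * (c (k + n) * z ^ k)) = (\<lambda>k. c (k + n) * z ^ (k + n))"
      by (simp add: power_add algebra_simps)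
    moreover have "(\<lambda>k. c (k + n) * z ^ (k + n)) sums (f z - (\<Sum>k<n. c k * z ^ k))"
      by (rule sums_split_initial_segment[OF f[OF z]])
    ultimately have "f z - (\<Sum>k<n. c k * z ^ k) = z ^ n * g z"
      using sums_unique2 by metis
    then show "f z = (\<Sum>k<n. (deriv ^^ k) f 0 / fact k * z ^ k) + z ^ n * g z"
      unfolding c_def by (simp add: algebra_simps)
  qed
qed

context period_lattice
begin

abbreviation "g2 \<equiv> lattice_invariant_g2 L"
abbreviation "g3 \<equiv> lattice_invariant_g3 L"

lemma q_0: "q 0 = 0"
  unfolding q_def by simp

text \<open>For odd \<open>n\<close> the summand is odd in \<open>w\<close> and the lattice is
  symmetric, so the sum equals its own negative.\<close>

lemma q_higher_deriv_0_odd: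
  assumes "odd n" shows "(deriv ^^ n) q 0 = 0"
proof -
  have n: "n \<ge> 1" using assms by presburger
  have s: "((\<lambda>w. (- 1) ^ n * fact (n + 1) / (0 - w) ^ (n + 2)) has_sum (deriv ^^ n) q 0) (L - {0})"
    by (rule q_higher_deriv_has_sum) (use n in auto)
  have "((\<lambda>w. - ((- 1) ^ n * fact (n + 1) / (0 - w) ^ (n + 2))) has_sum - (deriv ^^ n) q 0) (L - {0})"
    using s by (rule has_sum_uminusI)
  also have "?this \<longleftrightarrow> ((\<lambda>w. (- 1) ^ n * fact (n + 1) / (0 - w) ^ (n + 2)) has_sum - (deriv ^^ n) q 0) (L - {0})"
    by (rule has_sum_reindex_bij_witness[of _ uminus uminus])
      (use assms uminus_L_iff in \<open>auto simp: power_minus_odd\<close>)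
  finally have "- (deriv ^^ n) q 0 = (deriv ^^ n) q 0" using s has_sum_unique by blast
  then show ?thesis by simp
qed

lemma q_deriv_0_2: "(deriv ^^ 2) q 0 = g2 / 10"
proof -
  have "((\<lambda>w. 6 * (1 / w ^ 4)) has_sum (deriv ^^ 2) q 0) (L - {0})"
    using q_higher_deriv_has_sum[of 0 2] by (simp add: fact_numeral)
  then have "(deriv ^^ 2) q 0 = 6 * (\<Sum>\<^sub>\<infinity>w\<in>L - {0}. 1 / w ^ 4)"
    by (metis (no_types) infsumI infsum_cmult_right')
  then show ?thesis unfolding lattice_invariant_g2_def by simp
qed

lemma q_deriv_0_4: "(deriv ^^ 4) q 0 = 6 * g3 / 7"
proof -
  have "((\<lambda>w. 120 * (1 / w ^ 6)) has_sum (deriv ^^ 4) q 0) (L - {0})"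
    using q_higher_deriv_has_sum[of 0 4] by (simp add: fact_numeral)
  then have "(deriv ^^ 4) q 0 = 120 * (\<Sum>\<^sub>\<infinity>w\<in>L - {0}. 1 / w ^ 6)"
    by (metis (no_types) infsumI infsum_cmult_right')
  then show ?thesis unfolding lattice_invariant_g3_def by simp
qed

text \<open>Only even Taylor coefficients survive, and they are multiples of the invariants. The
  remainder has order 5 because the differential equation multiplies it by up to
  \<open>1 / z ^ 4\<close> and its defect is to vanish at 0.\<close>

lemma P_Laurent:
  obtains r T where "r > 0" "ball 0 r \<inter> L = {0}" "T holomorphic_on ball 0 r"
    "\<And>z. z \<in> ball 0 r \<Longrightarrow> q z = g2 / 20 * z ^ 2 + g3 / 28 * z ^ 4 + z ^ 5 * T z"
proof -
  obtain r where r: "r > 0" "q holomorphic_on ball 0 r" "ball 0 r \<inter> L = {0}"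
    using q_near_0 by blast
  obtain T where T: "T holomorphic_on ball 0 r"
    "\<And>z. z \<in> ball 0 r \<Longrightarrow> q z = (\<Sum>k<5. (deriv ^^ k) q 0 / fact k * z ^ k) + z ^ 5 * T z"
    using holomorphic_Taylor_split[OF r(2), of 5] by blast
  have "(\<Sum>k<5. (deriv ^^ k) q 0 / fact k * z ^ k) = g2 / 20 * z ^ 2 + g3 / 28 * z ^ 4" for z
  proof -
    have "{..<5::nat} = {0, 1, 2, 3, 4}" by auto
    then show ?thesis
      using q_higher_deriv_0_odd[of 1]
      by (simp add: fact_numeral q_0 q_higher_deriv_0_odd[of 3] q_deriv_0_2 q_deriv_0_4)
  qed
  then show ?thesis using that[OF r(1,3) T(1)] T(2) by simp
qed

lemma ode_defect_near_0:
  obtains r S where "r > 0" "ball 0 r \<inter> L = {0}" "S holomorphic_on ball 0 r"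
    "\<And>z. z \<in> ball 0 r - {0} \<Longrightarrow> (deriv P z) ^ 2 - (4 * P z ^ 3 - g2 * P z - g3) = z * S z"
proof -
  obtain r T where r: "r > 0" "ball 0 r \<inter> L = {0}" and T: "T holomorphic_on ball 0 r"
    and q: "\<And>z. z \<in> ball 0 r \<Longrightarrow> q z = g2 / 20 * z ^ 2 + g3 / 28 * z ^ 4 + z ^ 5 * T z"
    using P_Laurent by blast
  define A where "A = g2 / 20"
  define B where "B = g3 / 28"
  have AB: "g2 = 20 * A" "g3 = 28 * B" unfolding A_def B_def by auto
  \<comment> \<open>These strip off powers of \<open>z\<close>: \<open>deriv q z = z * V z\<close>
    and \<open>q z = z ^ 2 * W z\<close>. Then \<open>S\<close> is the defect divided by
    \<open>z\<close>, free of negative powers.\<close>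
  define U where "U z = 5 * T z + z * deriv T z" for z
  define V where "V z = 2 * A + 4 * B * z ^ 2 + z ^ 3 * U z" for z
  define W where "W z = A + B * z ^ 2 + z ^ 3 * T z" for z
  define S where "S z = z * V z ^ 2 - 4 * U z - 12 * T z - 12 * z * W z ^ 2 - 4 * z ^ 5 * W z ^ 3
      + 20 * A * z * W z" for z
  have dT: "deriv T holomorphic_on ball 0 r" by (rule holomorphic_deriv[OF T]) simp
  show ?thesis
  proof (rule that[OF r])
    show "S holomorphic_on ball 0 r"
      unfolding S_def V_def W_def U_def by (intro holomorphic_intros T dT)
    fix z :: complex assume z: "z \<in> ball 0 r - {0}"
    then have zL: "z \<notin> L" "z \<noteq> 0" using r(2) by blast+
    have dTz: "(T has_field_derivative deriv T z) (at z)"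
      using holomorphic_derivI[OF T] z by simp
    have pow: "((\<lambda>z. z ^ n) has_field_derivative of_nat n * z ^ (n - 1)) (at z)" for n
      by (auto intro!: derivative_eq_intros)
    have "((\<lambda>z. A * z ^ 2 + B * z ^ 4 + z ^ 5 * T z) has_field_derivative
        A * (of_nat 2 * z ^ (2 - 1)) + B * (of_nat 4 * z ^ (4 - 1)) +
        (z ^ 5 * deriv T z + of_nat 5 * z ^ (5 - 1) * T z)) (at z)"
      by (rule DERIV_add[OF DERIV_add[OF DERIV_cmult[OF pow] DERIV_cmult[OF pow]] DERIV_mult'[OF pow dTz]])
    also have "A * (of_nat 2 * z ^ (2 - 1)) + B * (of_nat 4 * z ^ (4 - 1)) +
        (z ^ 5 * deriv T z + of_nat 5 * z ^ (5 - 1) * T z) =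
        2 * A * z + 4 * B * z ^ 3 + z ^ 4 * U z"
      unfolding U_def by simp algebra
    finally have "((\<lambda>z. A * z ^ 2 + B * z ^ 4 + z ^ 5 * T z) has_field_derivative
        2 * A * z + 4 * B * z ^ 3 + z ^ 4 * U z) (at z)" .
    then have "(q has_field_derivative 2 * A * z + 4 * B * z ^ 3 + z ^ 4 * U z) (at z)"
      by (rule has_field_derivative_transform_within_open[OF _ open_ball[of 0 r]])
        (use z q in \<open>auto simp: A_def B_def\<close>)
    then have "deriv q z = 2 * A * z + 4 * B * z ^ 3 + z ^ 4 * U z" by (rule DERIV_imp_deriv)
    also have "\<dots> = z * V z" unfolding V_def by algebra
    finally have dq: "deriv q z = z * V z" .
    have "q z = A * z ^ 2 + B * z ^ 4 + z ^ 5 * T z"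
      unfolding A_def B_def by (rule q) (use z in simp)
    also have "\<dots> = z ^ 2 * W z" unfolding W_def by algebra
    finally have qW: "q z = z ^ 2 * W z" .
    have "(deriv P z) ^ 2 - (4 * P z ^ 3 - g2 * P z - g3) =
        (- 2 / z ^ 3 + z * V z) ^ 2 - (4 * (1 / z ^ 2 + z ^ 2 * W z) ^ 3
          - 20 * A * (1 / z ^ 2 + z ^ 2 * W z) - 28 * B)"
      using deriv_P_eq[OF zL(1)] P_eq[OF zL(1)] dq qW AB by simp
    also have "\<dots> = (- 4 * V z - 12 * W z + 20 * A + 28 * B * z ^ 2) / z ^ 2 + z ^ 2 * V z ^ 2
        - 12 * z ^ 2 * W z ^ 2 - 4 * z ^ 6 * W z ^ 3 + 20 * A * z ^ 2 * W z"
    proof -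
      \<comment> \<open>With \<open>z * i = 1\<close> as the only relation the claim becomes a
        polynomial identity, within reach of \<open>algebra\<close>.\<close>
      define i where "i = 1 / z"
      have i: "1 / z ^ 2 = i ^ 2" "- 2 / z ^ 3 = - 2 * i ^ 3" "x / z ^ 2 = x * i ^ 2" for x
        unfolding i_def by (auto simp: power_divide)
      have "z * i = 1" unfolding i_def using zL(2) by simp
      then show ?thesis unfolding i by algebra
    qed
    also have "- 4 * V z - 12 * W z + 20 * A + 28 * B * z ^ 2 = z ^ 2 * (z * (- 4 * U z - 12 * T z))"
      unfolding V_def W_def by algebra
    also have "z ^ 2 * (z * (- 4 * U z - 12 * T z)) / z ^ 2 = z * (- 4 * U z - 12 * T z)"
      using zL(2) by simp
    also have "z * (- 4 * U z - 12 * T z) + z ^ 2 * V z ^ 2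
        - 12 * z ^ 2 * W z ^ 2 - 4 * z ^ 6 * W z ^ 3 + 20 * A * z ^ 2 * W z = z * S z"
      unfolding S_def by algebra
    finally show "(deriv P z) ^ 2 - (4 * P z ^ 3 - g2 * P z - g3) = z * S z" .
  qed
qed

section \<open>Liouville's theorem for periodic functions and the differential equation\<close>

lemma real_coordinates: obtains s t :: real where "z = of_real s * a + of_real t * b"
proof -
  define x where "x = b / a"
  have im: "Im x \<noteq> 0" using ratio unfolding x_def by (simp add: complex_is_Real_iff)
  define t where "t = Im (z / a) / Im x"
  define s where "s = Re (z / a) - t * Re x"
  have "z / a = of_real s + of_real t * x"
    using im by (intro complex_eqI) (simp_all add: s_def t_def)
  then have "z = of_real s * a + of_real t * b"
    unfolding x_def using generators_nonzero by (simp add: field_simps)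
  then show ?thesis using that by blast
qed

text \<open>Subtracting the integer parts of the real coordinates moves every point into the compact
  parallelogram \<open>K\<close>, so \<open>f\<close> is bounded and Liouville's theorem
  applies.\<close>

lemma periodic_entire_constant:
  assumes "f holomorphic_on UNIV" and per: "\<And>v z. v \<in> L \<Longrightarrow> f (z + v) = f z"
  shows "f z = f 0"
proof -
  define g where "g = (\<lambda>(s::real, t::real). of_real s * a + of_real t * b)"
  define K where "K = g ` ({0..1} \<times> {0..1})"
  have "compact K" unfolding K_def g_def case_prod_beta
    by (intro compact_continuous_image compact_Times compact_Icc continuous_intros)
  then have "bounded (f ` K)"
    using assms(1) by (meson compact_continuous_image compact_imp_bounded continuous_on_subset
        holomorphic_on_imp_continuous_on subset_UNIV)
  moreover have "range f \<subseteq> f ` K"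
  proof clarify
    fix z
    obtain s t :: real where z: "z = of_real s * a + of_real t * b" using real_coordinates by blast
    define v where "v = of_int \<lfloor>s\<rfloor> * a + of_int \<lfloor>t\<rfloor> * b"
    have "v \<in> L" unfolding v_def lattice_gen_def by blast
    have "z = g (frac s, frac t) + v"
      unfolding z g_def v_def frac_def by (simp add: algebra_simps)
    then have "f z = f (g (frac s, frac t))" using per[OF \<open>v \<in> L\<close>] by simp
    moreover have "g (frac s, frac t) \<in> K"
      unfolding K_def by (rule imageI) (simp add: frac_lt_1 less_imp_le)
    ultimately show "f z \<in> f ` K" by blast
  qed
  ultimately have "bounded (range f)" using bounded_subset by blast
  then have "f constant_on UNIV" by (rule Liouville_theorem[OF assms(1)])
  then show ?thesis unfolding constant_on_def by (metis UNIV_I)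
qed

text \<open>The defect of the equation, extended to the lattice points, is entire and periodic,
  hence equal to its value 0 at the origin.\<close>

theorem P_ode:
  assumes "z \<notin> L" shows "(deriv P z) ^ 2 = 4 * P z ^ 3 - g2 * P z - g3"
proof -
  define g where "g z = (deriv P z) ^ 2 - (4 * P z ^ 3 - g2 * P z - g3)" for z
  \<comment> \<open>The value 0 is the right one: near the origin the defect is
    \<open>z * S z\<close>. Periodicity transports this to the other lattice points.\<close>
  define G where "G z = (if z \<in> L then 0 else g z)" for z
  obtain r S where r: "r > 0" "ball 0 r \<inter> L = {0}" and S: "S holomorphic_on ball 0 r"
    and gS: "\<And>z. z \<in> ball 0 r - {0} \<Longrightarrow> g z = z * S z"
    using ode_defect_near_0 unfolding g_def by blast
  have per: "G (z + v) = G z" if "v \<in> L" for v z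
    using that add_L_iff[OF that, of z] P_periodic[OF that, of z] deriv_P_periodic[of z v]
    unfolding G_def g_def by simp
  have "g holomorphic_on - L"
    unfolding g_def by (intro holomorphic_intros P_holomorphic deriv_P_holomorphic)
  then have G1: "G holomorphic_on - L"
    by (rule holomorphic_transform) (simp add: G_def)
  have "(\<lambda>z. z * S z) holomorphic_on ball 0 r" by (intro holomorphic_intros S)
  then have G0: "G holomorphic_on ball 0 r"
  proof (rule holomorphic_transform)
    fix z :: complex assume z: "z \<in> ball 0 r"
    show "z * S z = G z"
    proof (cases "z = 0")
      case False
      then have "z \<notin> L" using z r(2) by blast
      then show ?thesis using gS z False unfolding G_def by simp
    qed (use zero_in_L in \<open>simp add: G_def\<close>)
  qed
  have "G field_differentiable (at z)" for z
  proof (cases "z \<in> L")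
    case False
    then show ?thesis
      using holomorphic_on_imp_differentiable_at[OF G1 open_complement_L] by simp
  next
    case True
    have "(G has_field_derivative deriv G 0) (at (z + - z))"
      using holomorphic_derivI[OF G0, of 0] r(1) by simp
    then have "((\<lambda>x. G (x + - z)) has_field_derivative deriv G 0) (at z)"
      by (subst DERIV_shift[symmetric])
    moreover have "(\<lambda>x. G (x + - z)) = G" using per[OF uminus_in_L[OF True]] by blast
    ultimately show ?thesis unfolding field_differentiable_def by auto
  qed
  then have "G holomorphic_on UNIV" by (simp add: holomorphic_on_def field_differentiable_at_within)
  then have "G z = G 0" using per by (rule periodic_entire_constant)
  then show ?thesis using assms zero_in_L unfolding G_def g_def by simp
qed

end

subsection \<open>Uniqueness for autonomous polynomial differential equations\<close>

text \<open>Horner's scheme, one coefficient at a time. The holomorphic quotient \<open>k\<close>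
  turns the equation for the difference of two solutions into a linear one.\<close>

lemma poly_diff_factor:
  assumes "f holomorphic_on S" "g holomorphic_on S"
  shows "\<exists>k. k holomorphic_on S \<and> (\<forall>z. poly p (f z) - poly p (g z) = (f z - g z) * k z)"
proof (induction p)
  case 0
  show ?case by (intro exI[of _ "\<lambda>_. 0"]) (auto intro!: holomorphic_intros)
next
  case (pCons c p)
  then obtain k where k: "k holomorphic_on S"
    "\<And>z. poly p (f z) - poly p (g z) = (f z - g z) * k z" by blast
  have "(\<lambda>z. poly p (g z)) holomorphic_on S"
    by (induction p) (auto intro!: holomorphic_intros assms)
  then have "(\<lambda>z. f z * k z + poly p (g z)) holomorphic_on S"
    by (intro holomorphic_intros assms k)
  moreover have "poly (pCons c p) (f z) - poly (pCons c p) (g z) =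
      (f z - g z) * (f z * k z + poly p (g z))" for z
  proof -
    have "poly (pCons c p) (f z) - poly (pCons c p) (g z) =
        f z * (poly p (f z) - poly p (g z)) + (f z - g z) * poly p (g z)"
      by (simp add: algebra_simps)
    then show ?thesis unfolding k(2) by (simp add: algebra_simps)
  qed
  ultimately show ?case by blast
qed

text \<open>The difference \<open>h\<close> of two solutions satisfies a linear equation \<open>h'' = h * k\<close>, so by Leibniz
  all its derivatives at the base point vanish.\<close>

lemma second_order_ode_unique:
  assumes S: "open S" "connected S" "c \<in> S"
    and hol: "f holomorphic_on S" "g holomorphic_on S"
    and ode: "\<And>z. z \<in> S \<Longrightarrow> deriv (deriv f) z = poly p (f z)"
      "\<And>z. z \<in> S \<Longrightarrow> deriv (deriv g) z = poly p (g z)"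
    and init: "f c = g c" "deriv f c = deriv g c"
    and "z \<in> S"
  shows "f z = g z"
proof -
  define h where "h z = f z - g z" for z
  have h: "h holomorphic_on S" unfolding h_def by (intro holomorphic_intros hol)
  obtain k where k: "k holomorphic_on S"
    "\<And>z. poly p (f z) - poly p (g z) = h z * k z"
    using poly_diff_factor[OF hol] unfolding h_def by blast
  have diff: "deriv (\<lambda>z. F z - G z) w = deriv F w - deriv G w"
    if "F holomorphic_on S" "G holomorphic_on S" "w \<in> S" for F G w
    using that S(1) by (intro deriv_diff holomorphic_on_imp_differentiable_at[of _ S])
  have h1: "deriv h w = deriv f w - deriv g w" if "w \<in> S" for w
    unfolding h_def[abs_def] by (rule diff[OF hol that])
  have h2: "deriv (deriv h) w = h w * k w" if "w \<in> S" for w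
  proof -
    have "deriv (deriv h) w = deriv (\<lambda>w. deriv f w - deriv g w) w"
      by (rule deriv_cong_ev[OF eventually_mono[OF eventually_nhds_in_open[OF S(1) that] h1] refl])
    also have "\<dots> = deriv (deriv f) w - deriv (deriv g) w"
      by (rule diff) (use holomorphic_deriv hol S that in auto)
    finally show ?thesis using ode that k(2) by simp
  qed
  have "(deriv ^^ n) h c = 0" for n
  proof (induction n rule: less_induct)
    case (less n)
    consider "n = 0" | "n = 1" | m where "n = m + 2"
      by (metis One_nat_def Suc_1 add_2_eq_Suc' not0_implies_Suc)
    then show ?case
    proof cases
      case 1
      then show ?thesis using init unfolding h_def by simp
    next
      case 2
      then show ?thesis using init h1[OF S(3)] by simp
    next
      case 3
      have "(deriv ^^ n) h c = (deriv ^^ m) (deriv (deriv h)) c"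
        unfolding 3 funpow_add by (simp add: numeral_2_eq_2)
      also have "\<dots> = (deriv ^^ m) (\<lambda>w. h w * k w) c"
        by (rule higher_deriv_transform_within_open[of _ S])
          (use h k(1) h2 S in \<open>auto intro!: holomorphic_intros holomorphic_deriv\<close>)
      also have "\<dots> = (\<Sum>i = 0..m. of_nat (m choose i) * (deriv ^^ i) h c * (deriv ^^ (m - i)) k c)"
        by (rule higher_deriv_mult[OF h k(1) S(1,3)])
      also have "\<dots> = 0" using less 3 by (intro sum.neutral) auto
      finally show ?thesis .
    qed
  qed
  then have "h z = 0" using holomorphic_fun_eq_0_on_connected[OF h S(1,2) _ S(3) \<open>z \<in> S\<close>] by simp
  then show ?thesis unfolding h_def by simp
qed

text \<open>Differentiation gives 2 f' f'' = p'(f) f'. As \<open>f\<close> is not constant, f' is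
  nonzero on some ball, where it cancels; the identity theorem extends the result to
  \<open>S\<close>.\<close>

lemma first_order_ode_imp_second_order:
  assumes S: "open S" "connected S"
    and hol: "f holomorphic_on S"
    and ode: "\<And>z. z \<in> S \<Longrightarrow> (deriv f z) ^ 2 = poly p (f z)"
    and nonconst: "\<not> f constant_on S"
    and "z \<in> S"
  shows "deriv (deriv f) z = poly (smult (1/2) (pderiv p)) (f z)"
proof -
  define g where "g z = deriv (deriv f) z - poly (smult (1/2) (pderiv p)) (f z)" for z
  have df: "deriv f holomorphic_on S" by (rule holomorphic_deriv[OF hol S(1)])
  have ddf: "deriv (deriv f) holomorphic_on S" by (rule holomorphic_deriv[OF df S(1)])
  have polyf: "(\<lambda>z. poly r (f z)) holomorphic_on S" for r
    by (induction r) (auto intro!: holomorphic_intros hol)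
  have g: "g holomorphic_on S" unfolding g_def by (intro holomorphic_intros ddf polyf)
  have zero: "deriv f w = 0 \<or> g w = 0" if w: "w \<in> S" for w
  proof -
    have f1: "(f has_field_derivative deriv f w) (at w)"
      by (rule holomorphic_derivI[OF hol S(1) w])
    have f2: "(deriv f has_field_derivative deriv (deriv f) w) (at w)"
      by (rule holomorphic_derivI[OF df S(1) w])
    have "((\<lambda>z. (deriv f z) ^ 2) has_field_derivative 2 * deriv f w * deriv (deriv f) w) (at w)"
      using f2 by (auto intro!: derivative_eq_intros)
    then have "((\<lambda>z. poly p (f z)) has_field_derivative 2 * deriv f w * deriv (deriv f) w) (at w)"
      by (rule has_field_derivative_transform_within_open[OF _ S(1) w]) (rule ode)
    moreover have "((\<lambda>z. poly p (f z)) has_field_derivative poly (pderiv p) (f w) * deriv f w) (at w)"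
      by (rule DERIV_chain2[OF poly_DERIV f1])
    ultimately have "2 * deriv f w * deriv (deriv f) w = poly (pderiv p) (f w) * deriv f w"
      by (rule DERIV_unique)
    then have "2 * deriv f w * g w = 0" unfolding g_def by (simp add: algebra_simps)
    then show ?thesis by simp
  qed
  have "\<exists>w\<in>S. deriv f w \<noteq> 0"
  proof (rule ccontr)
    assume "\<not> ?thesis"
    then have "\<forall>w\<in>S - {}. (f has_field_derivative 0) (at w)"
      using holomorphic_derivI[OF hol S(1)] by fastforce
    then have "\<exists>c. \<forall>w\<in>S. f w = c"
      using DERIV_zero_connected_constant[OF S(2,1) finite.emptyI holomorphic_on_imp_continuous_on[OF hol]]
      by metis
    then show False using nonconst unfolding constant_on_def by blast
  qed
  then obtain w where w: "w \<in> S" "deriv f w \<noteq> 0" by blast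
  have "isCont (deriv f) w"
    using holomorphic_on_imp_continuous_on[OF df] S(1) w(1) continuous_on_eq_continuous_at by blast
  then obtain e where e: "e > 0" "\<And>x. dist w x < e \<Longrightarrow> deriv f x \<noteq> 0"
    using continuous_at_avoid w(2) by blast
  obtain d where d: "d > 0" "ball w d \<subseteq> S" using S(1) w(1) open_contains_ball by blast
  define U where "U = ball w (min d e)"
  have U: "U \<subseteq> S" "w \<in> U" "open U" unfolding U_def using d e(1) by auto
  have U0: "g x = 0" if "x \<in> U" for x
    using zero[of x] e(2)[of x] that U(1) unfolding U_def by auto
  have "g z = 0"
    by (rule analytic_continuation[OF g S U(1) w(1) _ U0 \<open>z \<in> S\<close>])
      (use U interior_limit_point interior_open in metis)
  then show ?thesis unfolding g_def by simp
qed

text \<open>At a zero of \<open>p\<close> the first-order equation has a constant solution as well,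
  so constants are excluded. That zero makes both derivatives at \<open>c\<close> vanish, which
  supplies the initial data for the second-order equation.\<close>

lemma first_order_ode_unique:
  assumes S: "open S" "connected S" "c \<in> S"
    and hol: "f holomorphic_on S" "g holomorphic_on S"
    and ode: "\<And>z. z \<in> S \<Longrightarrow> (deriv f z) ^ 2 = poly p (f z)"
      "\<And>z. z \<in> S \<Longrightarrow> (deriv g z) ^ 2 = poly p (g z)"
    and nonconst: "\<not> f constant_on S" "\<not> g constant_on S"
    and init: "f c = g c" "poly p (g c) = 0"
    and "z \<in> S"
  shows "f z = g z"
proof (rule second_order_ode_unique[OF S hol _ _ init(1) _ \<open>z \<in> S\<close>])
  show "deriv f c = deriv g c" using ode[OF S(3)] init by simp
qed (use first_order_ode_imp_second_order S hol ode nonconst in blast)+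

section \<open>Moebius transforms of \<open>P\<close> and translation by half-periods\<close>

context period_lattice
begin

text \<open>Otherwise the identity theorem makes \<open>P\<close> constant off \<open>L\<close>,
  against its pole at 0.\<close>

lemma P_not_constant:
  assumes "open U" "U \<noteq> {}" "U \<subseteq> - L"
  shows "\<not> P constant_on U"
proof
  assume "P constant_on U"
  then obtain c where c: "\<And>z. z \<in> U \<Longrightarrow> P z = c" unfolding constant_on_def by blast
  obtain u where u: "u \<in> U" using assms(2) by blast
  have Pc: "P z = c" if "z \<notin> L" for z
  proof -
    have "(\<lambda>z. P z - c) holomorphic_on - L" by (intro holomorphic_intros P_holomorphic)
    then have "P z - c = 0"
    proof (rule analytic_continuation[OF _ open_complement_L connected_complement_L assms(3)])
      show "u \<in> - L" using u assms(3) by auto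
      show "u islimpt U" using u assms(1) interior_limit_point interior_open by metis
    qed (use c that in auto)
    then show ?thesis by simp
  qed
  have "eventually (\<lambda>z. z \<in> - (L - {0})) (at 0)"
    using open_complement_L0 by (intro eventually_at_in_open') auto
  then have "eventually (\<lambda>z. P z = c) (at 0)"
    using eventually_neq_at_within[of "0::complex"] by eventually_elim (use Pc in auto)
  then have "P \<midarrow>0\<rightarrow> c" by (rule tendsto_eventually)
  then show False using filterlim_P_0 not_tendsto_and_filterlim_at_infinity[of "at 0" P] by auto
qed

text \<open>The condition on \<open>p\<close> makes
  \<open>\<alpha> + \<beta> / (P z - \<gamma>)\<close> solve the same equation as \<open>f\<close>.
  Its value at 0 is \<open>\<alpha>\<close> because \<open>P\<close> has a pole there, so uniqueness
  identifies both near 0. It is applied to translates of \<open>P\<close> and to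
  \<open>y\<close>.\<close>

lemma Moebius_of_P:
  fixes \<alpha> \<beta> \<gamma> :: complex and p :: "complex poly"
  assumes "\<beta> \<noteq> 0" "poly p \<alpha> = 0"
    and p: "\<And>u. u \<noteq> 0 \<Longrightarrow>
      poly p (\<alpha> + \<beta> / u) * u ^ 4 = \<beta> ^ 2 * (4 * (\<gamma> + u) ^ 3 - g2 * (\<gamma> + u) - g3)"
    and f: "R > 0" "f holomorphic_on ball 0 R" "f 0 = \<alpha>"
      "\<And>z. z \<in> ball 0 R \<Longrightarrow> (deriv f z) ^ 2 = poly p (f z)"
      "\<And>s. s > 0 \<Longrightarrow> \<not> f constant_on ball 0 s"
  obtains s where "s > 0" "s \<le> R" "ball 0 s \<inter> L = {0}"
    "\<And>z. z \<in> ball 0 s - {0} \<Longrightarrow> (f z - \<alpha>) * (P z - \<gamma>) = \<beta>"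
proof -
  obtain r where r: "r > 0" "q holomorphic_on ball 0 r" "ball 0 r \<inter> L = {0}"
    using q_near_0 by blast
  \<comment> \<open>This is \<open>z ^ 2 * (P z - \<gamma>)\<close> with the pole removed and
    \<open>D 0 = 1\<close>, so that \<open>M\<close> below makes sense at the origin too.\<close>
  define D where "D z = 1 + z ^ 2 * (q z - \<gamma>)" for z
  have D: "D holomorphic_on ball 0 r" unfolding D_def by (intro holomorphic_intros r)
  then have "isCont D 0"
    using r(1) by (meson centre_in_ball continuous_on_eq_continuous_at holomorphic_on_imp_continuous_on open_ball)
  moreover have "D 0 \<noteq> 0" unfolding D_def by simp
  ultimately obtain e where e: "e > 0" "\<And>z. dist 0 z < e \<Longrightarrow> D z \<noteq> 0"
    using continuous_at_avoid by blast
  define s where "s = min R (min r e)"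
  define S where "S = ball (0::complex) s"
  have s: "s > 0" "s \<le> R" unfolding s_def using r(1) e(1) f(1) by auto
  have sub: "S \<subseteq> ball 0 r" "S \<subseteq> ball 0 R" unfolding S_def s_def by (auto intro!: subset_ball)
  have S: "open S" "connected S" "0 \<in> S" unfolding S_def using s by auto
  have Dnz: "D z \<noteq> 0" if "z \<in> S" for z using e(2) that unfolding S_def s_def by auto
  have SL: "S \<inter> L = {0}" using sub(1) r(3) S(3) by blast
  define M where "M z = \<alpha> + \<beta> * z ^ 2 / D z" for z
  have M: "M holomorphic_on S" unfolding M_def
    by (intro holomorphic_intros holomorphic_on_subset[OF D sub(1)]) (use Dnz in auto)
  have PD: "P z - \<gamma> = D z / z ^ 2" if "z \<in> S" "z \<noteq> 0" for z
  proof -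
    have "z \<notin> L" using that SL by blast
    then show ?thesis using that P_eq unfolding D_def by (simp add: field_simps)
  qed
  have MP: "M z = \<alpha> + \<beta> / (P z - \<gamma>)" "P z - \<gamma> \<noteq> 0" if "z \<in> S" "z \<noteq> 0" for z
    using PD[OF that] Dnz[OF that(1)] that(2) unfolding M_def by auto
  have M_ode: "(deriv M z) ^ 2 = poly p (M z)" if z: "z \<in> S" for z
  proof (cases "z = 0")
    case True
    \<comment> \<open>\<open>M - \<alpha>\<close> has the factor \<open>z ^ 2\<close>, so
      \<open>deriv M 0 = 0\<close>, in accordance with \<open>poly p \<alpha> = 0\<close>.\<close>
    have "(D has_field_derivative deriv D 0) (at 0)"
      using holomorphic_derivI[OF D] r(1) by simp
    then have "(M has_field_derivative 0) (at 0)"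
      unfolding M_def using \<open>D 0 \<noteq> 0\<close> by (auto intro!: derivative_eq_intros)
    then have "deriv M 0 = 0" by (rule DERIV_imp_deriv)
    moreover have "M 0 = \<alpha>" unfolding M_def by simp
    ultimately show ?thesis using True assms(2) by simp
  next
    case False
    have zL: "z \<notin> L" using z SL False by blast
    define u where "u = P z - \<gamma>"
    have u: "u \<noteq> 0" using MP z False unfolding u_def by blast
    have "((\<lambda>z. \<alpha> + \<beta> / (P z - \<gamma>)) has_field_derivative - (\<beta> * deriv P z) / u ^ 2) (at z)"
      using u P_has_deriv[OF zL] unfolding u_def
      by (auto intro!: derivative_eq_intros simp: power2_eq_square)
    then have "(M has_field_derivative - (\<beta> * deriv P z) / u ^ 2) (at z)"
      by (rule has_field_derivative_transform_within_open[of _ _ _ "S - {0}"])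
        (use z False S MP in auto)
    then have "(deriv M z) ^ 2 = (- (\<beta> * deriv P z) / u ^ 2) ^ 2" by (simp add: DERIV_imp_deriv)
    also have "\<dots> = \<beta> ^ 2 * (deriv P z) ^ 2 / u ^ 4"
      by (simp add: power_divide power_mult_distrib flip: power_mult)
    also have "\<beta> ^ 2 * (deriv P z) ^ 2 = poly p (\<alpha> + \<beta> / u) * u ^ 4"
      using p[OF u] P_ode[OF zL] unfolding u_def by simp
    also have "poly p (\<alpha> + \<beta> / u) * u ^ 4 / u ^ 4 = poly p (M z)"
      using u MP(1)[OF z False] unfolding u_def by simp
    finally show ?thesis .
  qed
  have M_nonconst: "\<not> M constant_on S"
  proof
    assume "M constant_on S"
    moreover have "of_real (s / 2) \<in> S" unfolding S_def using s by simp
    ultimately have "M (of_real (s / 2)) = M 0" using S(3) unfolding constant_on_def by metis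
    then show False
      using assms(1) s(1) Dnz[OF \<open>of_real (s / 2) \<in> S\<close>] unfolding M_def by simp
  qed
  have eq: "f z = M z" if "z \<in> S" for z
  proof (rule first_order_ode_unique[OF S, where f = f and g = M and p = p and z = z])
    show "f holomorphic_on S" by (rule holomorphic_on_subset[OF f(2) sub(2)])
    show "\<not> f constant_on S" unfolding S_def by (rule f(5)[OF s(1)])
  qed (use M M_ode M_nonconst f sub assms(2) that in \<open>auto simp: M_def\<close>)
  have "(f z - \<alpha>) * (P z - \<gamma>) = \<beta>" if "z \<in> ball 0 s - {0}" for z
    using eq[of z] MP[of z] that unfolding S_def by simp
  then show ?thesis using that[OF s] SL unfolding S_def by blast
qed

lemma deriv_P_odd: "z \<notin> L \<Longrightarrow> deriv P (- z) = - deriv P z"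
proof -
  assume z: "z \<notin> L"
  then have "((\<lambda>z. P (- z)) has_field_derivative deriv P (- z) * - 1) (at z)"
    by (intro DERIV_chain2[of P] P_has_deriv) (auto simp: uminus_L_iff intro!: derivative_eq_intros)
  then have "(P has_field_derivative - deriv P (- z)) (at z)" unfolding P_even by simp
  then have "deriv P z = - deriv P (- z)" by (rule DERIV_imp_deriv)
  then show ?thesis by simp
qed

text \<open>By periodicity \<open>deriv P\<close> agrees at \<open>w\<close> and \<open>- w\<close>;
  being odd, it has opposite values there.\<close>

lemma deriv_P_half_period:
  assumes "w \<notin> L" "2 * w \<in> L" shows "deriv P w = 0"
proof -
  have "deriv P w = deriv P (- w + 2 * w)" by simp
  also have "\<dots> = deriv P (- w)" by (rule deriv_P_periodic) (use assms uminus_L_iff in auto)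
  finally show ?thesis using deriv_P_odd[OF assms(1)] by simp
qed

lemma P_half_period_root:
  assumes "w \<notin> L" "2 * w \<in> L"
  shows "4 * P w ^ 3 - g2 * P w - g3 = 0"
  using P_ode[OF assms(1)] deriv_P_half_period[OF assms] by simp

text \<open>The Moebius map that sends \<open>e1 + u\<close> to \<open>e1 + \<beta> / u\<close>
  exchanges \<open>e2\<close> with \<open>e3\<close> and \<open>e1\<close> with infinity, so it
  preserves the cubic equation. \<open>Moebius_of_P\<close> matches its composition with
  \<open>P\<close> to the translate, whose value at 0 is \<open>e1\<close>; analytic continuation
  does the rest.\<close>

lemma P_translate_half_period:
  assumes w: "w \<notin> L" "2 * w \<in> L" and "P w = e1"
    and roots: "\<And>x. 4 * x ^ 3 - g2 * x - g3 = 4 * (x - e1) * (x - e2) * (x - e3)"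
    and distinct: "e1 \<noteq> e2" "e1 \<noteq> e3"
    and z: "z \<notin> L" "z + w \<notin> L"
  shows "(P (z + w) - e1) * (P z - e1) = (e1 - e2) * (e1 - e3)"
proof -
  define \<beta> where "\<beta> = (e1 - e2) * (e1 - e3)"
  define p where "p = [:- g3, - g2, 0, 4:]"
  have p: "poly p x = 4 * (x - e1) * (x - e2) * (x - e3)" for x
    unfolding roots[symmetric] p_def by (simp add: algebra_simps power_numeral_reduce)
  \<comment> \<open>The poles of the translate. They are countable, so removing them together with
    \<open>L\<close> keeps the domain connected.\<close>
  define T where "T = {z. z + w \<in> L}"
  have T: "T = (\<lambda>z. z - w) ` L" unfolding T_def by (force simp: image_iff)
  have "open (- T)"
    unfolding T using open_complement_L closed_translation_subtract[of L w] by (simp add: open_closed)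
  then have openD: "open (- (L \<union> T))" using open_complement_L by (simp add: open_Int)
  have connD: "connected (- (L \<union> T))"
    by (intro path_connected_imp_connected path_connected_complement_countable)
      (use countable_L T in auto)
  obtain R where R: "R > 0" "ball 0 R \<subseteq> - T"
    using \<open>open (- T)\<close> w(1) open_contains_ball[of "- T"] by (force simp: T_def)
  have chain: "((\<lambda>z. P (z + w)) has_field_derivative deriv P (z + w)) (at z)" if "z \<notin> T" for z
  proof -
    have "((\<lambda>z. P (z + w)) has_field_derivative deriv P (z + w) * (1 + 0)) (at z)"
      by (intro DERIV_chain2[of P] DERIV_add DERIV_ident DERIV_const P_has_deriv)
        (use that in \<open>auto simp: T_def\<close>)
    then show ?thesis by simp
  qed
  obtain s where s: "s > 0" "s \<le> R" "ball 0 s \<inter> L = {0}"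
    "\<And>z. z \<in> ball 0 s - {0} \<Longrightarrow> (P (z + w) - e1) * (P z - e1) = \<beta>"
  proof (rule Moebius_of_P[of \<beta> p e1 e1 R "\<lambda>z. P (z + w)"])
    show "\<beta> \<noteq> 0" unfolding \<beta>_def using distinct by simp
    show "poly p e1 = 0" unfolding p by simp
    show "R > 0" by (rule R(1))
    show "P (0 + w) = e1" using assms(3) by simp
    show "(\<lambda>z. P (z + w)) holomorphic_on ball 0 R"
      unfolding holomorphic_on_open[OF open_ball] using chain R(2) by blast
    show "(deriv (\<lambda>z. P (z + w)) z) ^ 2 = poly p (P (z + w))" if "z \<in> ball 0 R" for z
    proof -
      have "z \<notin> T" using that R(2) by blast
      then show ?thesis
        using DERIV_imp_deriv[OF chain] P_ode[of "z + w"] roots[of "P (z + w)"] p by (simp add: T_def)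
    qed
    show "\<not> (\<lambda>z. P (z + w)) constant_on ball 0 s" if "s > 0" for s
    proof
      assume "(\<lambda>z. P (z + w)) constant_on ball 0 s"
      then obtain c where c: "\<And>z. z \<in> ball 0 s \<Longrightarrow> P (z + w) = c" unfolding constant_on_def by blast
      have "P x = c" if "x \<in> ball w s \<inter> - L" for x
        using c[of "x - w"] that by (simp add: dist_norm norm_minus_commute)
      then have "P constant_on (ball w s \<inter> - L)" unfolding constant_on_def by blast
      moreover have "w \<in> ball w s \<inter> - L" using w(1) that by simp
      ultimately show False
        using P_not_constant[OF _ _ Int_lower2] open_Int[OF open_ball open_complement_L] by blast
    qed
    show "poly p (e1 + \<beta> / u) * u ^ 4 = \<beta> ^ 2 * (4 * (e1 + u) ^ 3 - g2 * (e1 + u) - g3)"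
      if u: "u \<noteq> 0" for u
    proof -
      have "poly p (e1 + \<beta> / u) * u ^ 4 =
          4 * \<beta> * u * (u * (\<beta> / u + (e1 - e2))) * (u * (\<beta> / u + (e1 - e3)))"
        unfolding p using u by (simp add: field_simps power_numeral_reduce)
      also have "u * (\<beta> / u + (e1 - e2)) = (e1 - e2) * (e1 + u - e3)"
        unfolding \<beta>_def using u by (simp add: field_simps)
      also have "u * (\<beta> / u + (e1 - e3)) = (e1 - e3) * (e1 + u - e2)"
        unfolding \<beta>_def using u by (simp add: field_simps)
      also have "4 * \<beta> * u * ((e1 - e2) * (e1 + u - e3)) * ((e1 - e3) * (e1 + u - e2)) =
          \<beta> ^ 2 * (4 * (e1 + u - e1) * (e1 + u - e2) * (e1 + u - e3))"
        unfolding \<beta>_def by (simp add: power2_eq_square)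
      finally show ?thesis unfolding roots .
    qed
  qed blast
  define F where "F z = (P (z + w) - e1) * (P z - e1) - \<beta>" for z
  have "(\<lambda>z. P (z + w)) holomorphic_on - (L \<union> T)"
    unfolding holomorphic_on_open[OF openD] using chain by blast
  then have F: "F holomorphic_on - (L \<union> T)"
    unfolding F_def by (intro holomorphic_intros holomorphic_on_subset[OF P_holomorphic]) auto
  define U where "U = ball 0 s - {0::complex}"
  have U: "U \<subseteq> - (L \<union> T)" unfolding U_def using subset_ball[OF s(2), of "0::complex"] s(3) R(2) by blast
  have "of_real (s / 2) \<in> U" unfolding U_def using s(1) by simp
  moreover have "open U" unfolding U_def by (intro open_Diff) auto
  ultimately have lim: "of_real (s / 2) islimpt U" and "of_real (s / 2) \<in> - (L \<union> T)"
    using interior_limit_point interior_open U by (metis, blast)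
  have "F z = 0"
    by (rule analytic_continuation[OF F openD connD U _ lim])
      (use s(4) z \<open>of_real (s / 2) \<in> - (L \<union> T)\<close> in \<open>auto simp: F_def U_def T_def\<close>)
  then show ?thesis unfolding F_def \<beta>_def by simp
qed

end

subsection \<open>Real values on a rectangular lattice\<close>

text \<open>To pass the gap the function would have to attain the midpoint of \<open>u\<close> and
  \<open>v\<close>. One point known to lie below thus confines the whole image.\<close>

lemma connected_image_avoids_gap:
  fixes f :: "'a::topological_space \<Rightarrow> real"
  assumes "connected I" "continuous_on I f" "u < v"
    and gap: "\<And>x. x \<in> I \<Longrightarrow> f x \<le> u \<or> v \<le> f x"
    and "x \<in> I" "y \<in> I" "f x < v"
  shows "f y \<le> u"
proof (rule ccontr)
  assume "\<not> f y \<le> u"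
  then have "f x \<le> (u + v) / 2" "(u + v) / 2 \<le> f y"
    using gap[OF \<open>x \<in> I\<close>] gap[OF \<open>y \<in> I\<close>] assms(3,7) by auto
  then have "(u + v) / 2 \<in> f ` I"
    using connectedD_interval[OF connected_continuous_image[OF assms(2,1)]] assms(5,6) by blast
  then show False using gap assms(3) by force
qed

lemma cubic_nonneg_cases:
  fixes x :: real
  assumes "e3 < e2" "e2 < e1" "0 \<le> (x - e1) * (x - e2) * (x - e3)"
  shows "e3 \<le> x \<and> x \<le> e2 \<or> e1 \<le> x"
proof (rule ccontr)
  assume "\<not> ?thesis"
  then consider "x < e3" | "e2 < x" "x < e1" by linarith
  then have "(x - e1) * (x - e2) * (x - e3) < 0"
    by cases (use assms(1,2) in \<open>auto intro!: mult_pos_neg mult_neg_pos mult_neg_neg simp: mult_less_0_iff zero_less_mult_iff\<close>)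
  then show False using assms(3) by simp
qed

lemma cubic_nonpos_cases:
  fixes x :: real
  assumes "e3 < e2" "e2 < e1" "(x - e1) * (x - e2) * (x - e3) \<le> 0"
  shows "x \<le> e3 \<or> e2 \<le> x \<and> x \<le> e1"
  using assms by (auto simp: mult_le_0_iff)

context period_lattice
begin

text \<open>Conjugation permutes the lattice and hence the terms of the series.\<close>

lemma P_cnj:
  assumes cnj_L: "\<And>w. w \<in> L \<Longrightarrow> cnj w \<in> L"
  shows "P (cnj z) = cnj (P z)"
proof -
  have iff: "cnj w \<in> L \<longleftrightarrow> w \<in> L" for w using cnj_L[of w] cnj_L[of "cnj w"] by auto
  have "q (cnj z) = (\<Sum>\<^sub>\<infinity>w\<in>L - {0}. cnj (1 / (z - w) ^ 2 - 1 / w ^ 2))"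
    unfolding q_def by (rule infsum_reindex_bij_witness[of _ cnj cnj]) (use iff in auto)
  also have "\<dots> = cnj (q z)" unfolding q_def by (rule infsum_cnj)
  finally show ?thesis using P_eq P_on_L iff[of z] by (cases "z \<in> L") auto
qed

text \<open>Along a line on which \<open>P\<close> is real, the derivative of \<open>P\<close> in the direction of the line
  is real, so its square, which the differential equation expresses by the cubic, is nonnegative.\<close>

lemma cubic_sign_on_real_line:
  fixes e1 e2 e3 \<sigma> s t x :: real
  assumes roots: "\<And>x. 4 * x ^ 3 - g2 * x - g3 = 4 * (x - of_real e1) * (x - of_real e2) * (x - of_real e3)"
    and d: "d ^ 2 = of_real \<sigma>" and x: "x \<in> {s<..<t}"
    and line: "\<And>x. x \<in> {s<..<t} \<Longrightarrow> u + of_real x * d \<notin> L"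
      "\<And>x. x \<in> {s<..<t} \<Longrightarrow> P (u + of_real x * d) \<in> \<real>"
  shows "0 \<le> \<sigma> * ((Re (P (u + of_real x * d)) - e1) * (Re (P (u + of_real x * d)) - e2)
    * (Re (P (u + of_real x * d)) - e3))"
proof -
  define z where "z = u + of_real x * d"
  define X where "X = Re (P z)"
  have PX: "P z = of_real X" using line(2)[OF x] unfolding X_def z_def by simp
  have zL: "z \<notin> L" using line(1)[OF x] unfolding z_def .
  have "((\<lambda>y. u + of_real y * d) has_vector_derivative d) (at x)"
    by (auto intro!: derivative_eq_intros)
  then have "((P \<circ> (\<lambda>y. u + of_real y * d)) has_vector_derivative d * deriv P z) (at x)"
    by (rule field_vector_diff_chain_at) (use P_has_deriv[OF zL] in \<open>simp add: z_def\<close>)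
  then have "((\<lambda>y. Im (P (u + of_real y * d))) has_vector_derivative Im (d * deriv P z)) (at x)"
    unfolding o_def by (rule bounded_linear.has_vector_derivative[OF bounded_linear_Im])
  then have "((\<lambda>y. Im (P (u + of_real y * d))) has_field_derivative Im (d * deriv P z)) (at x)"
    by (simp add: has_real_derivative_iff_has_vector_derivative)
  then have "((\<lambda>y. 0) has_field_derivative Im (d * deriv P z)) (at x)"
    by (rule has_field_derivative_transform_within_open[of _ _ _ "{s<..<t}"])
      (use x line(2) in \<open>auto simp: complex_is_Real_iff\<close>)
  then have "Im (d * deriv P z) = 0" using DERIV_unique DERIV_const by blast
  then have "d * deriv P z = of_real (Re (d * deriv P z))" by (simp add: complex_eq_iff)
  then have "of_real ((Re (d * deriv P z)) ^ 2) = d ^ 2 * (deriv P z) ^ 2"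
    by (metis of_real_power power_mult_distrib)
  also have "\<dots> = of_real (4 * (\<sigma> * ((X - e1) * (X - e2) * (X - e3))))"
    using d P_ode[OF zL] roots[of "P z"] PX by simp
  finally have "4 * (\<sigma> * ((X - e1) * (X - e2) * (X - e3))) = (Re (d * deriv P z)) ^ 2"
    unfolding of_real_eq_iff by simp
  moreover have "0 \<le> (Re (d * deriv P z)) ^ 2" by simp
  ultimately have "0 \<le> \<sigma> * ((X - e1) * (X - e2) * (X - e3))" by linarith
  then show ?thesis unfolding X_def z_def .
qed

text \<open>Provides the point from which \<open>connected_image_avoids_gap\<close> is applied on
  the two axes; it comes from the pole at 0.\<close>

lemma P_large_near_0:
  assumes "d \<noteq> 0" "(t::real) > 0"
  obtains x where "x \<in> {0<..<t}" "B < cmod (P (of_real x * d))"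
proof -
  have "eventually (\<lambda>z. B < cmod (P z)) (at 0)"
    using filterlim_P_0 unfolding filterlim_at_infinity_conv_norm_at_top filterlim_at_top_dense by blast
  then obtain e where e: "e > 0" "\<And>z. z \<noteq> 0 \<Longrightarrow> dist z 0 < e \<Longrightarrow> B < cmod (P z)"
    unfolding eventually_at by blast
  define x where "x = min (t / 2) (e / (2 * cmod d))"
  have x: "x > 0" "x < t" unfolding x_def using assms e(1) by auto
  have "x * cmod d \<le> e / (2 * cmod d) * cmod d"
    unfolding x_def by (intro mult_right_mono) auto
  also have "\<dots> < e" using assms e(1) by simp
  finally have "B < cmod (P (of_real x * d))"
    using e(2)[of "of_real x * d"] x assms by (simp add: norm_mult)
  then show ?thesis using that x by simp
qed

lemma continuous_on_P_line:
  assumes "\<And>x. x \<in> I \<Longrightarrow> u + of_real x * d \<notin> L"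
  shows "continuous_on I (\<lambda>x::real. Re (P (u + of_real x * d)))"
  by (intro continuous_on_Re continuous_on_compose2[OF holomorphic_on_imp_continuous_on[OF P_holomorphic]]
      continuous_intros) (use assms in auto)

end

section \<open>Values of \<open>P\<close> on a rectangular lattice whose cubic has three real
  roots\<close>

locale rectangular_lattice = period_lattice "of_real (2 * \<omega>)" "of_real (2 * \<eta>) * \<i>" for \<omega> \<eta> :: real +
  fixes e1 e2 e3 :: real
  assumes half_periods_pos: "\<omega> > 0" "\<eta> > 0"
    and roots: "\<And>x. 4 * x ^ 3 - g2 * x - g3 = 4 * (x - of_real e1) * (x - of_real e2) * (x - of_real e3)"
    and roots_less: "e3 < e2" "e2 < e1"
begin

lemma in_L_iff: "z \<in> L \<longleftrightarrow> (\<exists>m n::int. Re z = 2 * of_int m * \<omega> \<and> Im z = 2 * of_int n * \<eta>)"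
  unfolding lattice_gen_def by (auto simp: complex_eq_iff)

lemma cnj_in_L: "w \<in> L \<Longrightarrow> cnj w \<in> L"
proof -
  assume "w \<in> L"
  then obtain m n :: int where "Re w = 2 * of_int m * \<omega>" "Im w = 2 * of_int n * \<eta>"
    unfolding in_L_iff by blast
  then have "Re (cnj w) = 2 * of_int m * \<omega>" "Im (cnj w) = 2 * of_int (- n) * \<eta>" by auto
  then show ?thesis unfolding in_L_iff by blast
qed

lemma even_multiple_bounds:
  fixes m :: int and h x :: real
  assumes "h > 0" "x \<in> {0<..<2 * h}" shows "x \<noteq> 2 * of_int m * h"
proof
  assume x: "x = 2 * of_int m * h"
  moreover have "0 < x" "x < 2 * h" using assms(2) by auto
  ultimately have "0 * h < of_int m * h" "of_int m * h < 1 * h" by linarith+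
  then have "0 < m \<and> m < 1" using assms(1) by (auto simp: zero_less_mult_iff)
  then show False by presburger
qed

lemma real_line: assumes "x \<in> {0<..<2 * \<omega>}"
  shows "of_real x \<notin> L" "P (of_real x) \<in> \<real>"
proof -
  show "of_real x \<notin> L"
    unfolding in_L_iff using even_multiple_bounds[OF half_periods_pos(1) assms] by auto
  show "P (of_real x) \<in> \<real>"
    using P_cnj[OF cnj_in_L, of "of_real x"] by (simp add: Reals_cnj_iff)
qed

text \<open>On the imaginary axis conjugation is negation, and \<open>P\<close> is even.\<close>

lemma imaginary_line: assumes "x \<in> {0<..<2 * \<eta>}"
  shows "of_real x * \<i> \<notin> L" "P (of_real x * \<i>) \<in> \<real>"
proof -
  show "of_real x * \<i> \<notin> L"
    unfolding in_L_iff using even_multiple_bounds[OF half_periods_pos(2) assms] by auto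
  show "P (of_real x * \<i>) \<in> \<real>"
    using P_cnj[OF cnj_in_L, of "of_real x * \<i>"] P_even[of "of_real x * \<i>"]
    by (simp add: Reals_cnj_iff)
qed

text \<open>Conjugation followed by translation by the period
  \<open>of_real (2 * \<eta>) * \<i>\<close> fixes this line pointwise.\<close>

lemma shifted_line: "of_real \<eta> * \<i> + of_real x \<notin> L" "P (of_real \<eta> * \<i> + of_real x) \<in> \<real>"
proof -
  show "of_real \<eta> * \<i> + of_real x \<notin> L"
    unfolding in_L_iff using even_multiple_bounds[OF half_periods_pos(2), of \<eta>] half_periods_pos by auto
  have "cnj (of_real \<eta> * \<i> + of_real x) + of_real (2 * \<eta>) * \<i> = of_real \<eta> * \<i> + of_real x"
    by (simp add: complex_eq_iff)
  then have "P (cnj (of_real \<eta> * \<i> + of_real x)) = P (of_real \<eta> * \<i> + of_real x)"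
    using P_periodic[OF generators_in_L(2)] by metis
  then show "P (of_real \<eta> * \<i> + of_real x) \<in> \<real>"
    using P_cnj[OF cnj_in_L] by (metis Reals_cnj_iff)
qed

lemma P_real_line_ge:
  assumes x: "x \<in> {0<..<2 * \<omega>}" shows "e1 \<le> Re (P (of_real x))"
proof -
  define f where "f x = Re (P (of_real x))" for x
  have cases: "e3 \<le> f x \<and> f x \<le> e2 \<or> e1 \<le> f x" if "x \<in> {0<..<2 * \<omega>}" for x
    using cubic_nonneg_cases[OF roots_less, of "f x"]
      cubic_sign_on_real_line[OF roots, where \<sigma> = 1 and d = 1 and u = 0 and s = 0 and t = "2 * \<omega>" and x = x]
      real_line that unfolding f_def by simp
  have cont: "continuous_on {0<..<2 * \<omega>} f"
    using continuous_on_P_line[of "{0<..<2 * \<omega>}" 0 1] real_line(1) unfolding f_def by simp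
  \<comment> \<open>A size beyond \<open>\<bar>e2\<bar> + \<bar>e3\<bar>\<close> excludes the
    interval from \<open>e3\<close> to \<open>e2\<close>, so the value at \<open>y\<close> is at
    least \<open>e1\<close>.\<close>
  obtain y where y: "y \<in> {0<..<2 * \<omega>}" "\<bar>e2\<bar> + \<bar>e3\<bar> < cmod (P (of_real y * 1))"
    using P_large_near_0[of 1 "2 * \<omega>"] half_periods_pos by auto
  have "cmod (P (of_real y)) = \<bar>f y\<bar>"
    using real_line(2)[OF y(1)] unfolding f_def by (metis norm_of_real of_real_Re)
  then have fy: "\<not> f y \<le> e2" using y cases[OF y(1)] roots_less by auto
  have "\<not> f x < e1"
    using connected_image_avoids_gap[OF connected_Ioo cont roots_less(2) _ x y(1)] cases fy by blast
  then show ?thesis unfolding f_def by simp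
qed

lemma P_imaginary_line_le:
  assumes x: "x \<in> {0<..<2 * \<eta>}" shows "Re (P (of_real x * \<i>)) \<le> e3"
proof -
  define f where "f x = Re (P (of_real x * \<i>))" for x
  \<comment> \<open>The direction \<open>\<i>\<close> has square -1, so here the cubic is
    nonpositive. The pole at 0 then rules out the interval from \<open>e2\<close> to
    \<open>e1\<close>.\<close>
  have cases: "f x \<le> e3 \<or> e2 \<le> f x \<and> f x \<le> e1" if "x \<in> {0<..<2 * \<eta>}" for x
    using cubic_nonpos_cases[OF roots_less, of "f x"]
      cubic_sign_on_real_line[OF roots, where \<sigma> = "- 1" and d = \<i> and u = 0 and s = 0 and t = "2 * \<eta>" and x = x]
      imaginary_line that unfolding f_def by simp
  have cont: "continuous_on {0<..<2 * \<eta>} f"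
    using continuous_on_P_line[of "{0<..<2 * \<eta>}" 0 \<i>] imaginary_line(1) unfolding f_def by simp
  obtain y where y: "y \<in> {0<..<2 * \<eta>}" "\<bar>e1\<bar> + \<bar>e2\<bar> < cmod (P (of_real y * \<i>))"
    using P_large_near_0[of \<i> "2 * \<eta>"] half_periods_pos by auto
  have "cmod (P (of_real y * \<i>)) = \<bar>f y\<bar>"
    using imaginary_line(2)[OF y(1)] unfolding f_def by (metis norm_of_real of_real_Re)
  then have fy: "f y < e2" using y cases[OF y(1)] roots_less by auto
  show ?thesis
    using connected_image_avoids_gap[OF connected_Ioo cont roots_less(1) _ y(1) x fy] cases
    unfolding f_def by blast
qed

text \<open>No pole lies on this line, so the starting value is taken where it meets the imaginary
  axis: there \<open>P_imaginary_line_le\<close> gives at most \<open>e3\<close>.\<close>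

lemma P_shifted_line_le: "Re (P (of_real \<eta> * \<i> + of_real x)) \<le> e2"
proof -
  define f where "f x = Re (P (of_real \<eta> * \<i> + of_real x))" for x
  have cases: "f x \<le> e2 \<or> e1 \<le> f x" for x
    using cubic_nonneg_cases[OF roots_less, of "f x"]
      cubic_sign_on_real_line[OF roots, where \<sigma> = 1 and d = 1 and u = "of_real \<eta> * \<i>"
        and s = "x - 1" and t = "x + 1" and x = x]
      shifted_line unfolding f_def by auto
  have cont: "continuous_on UNIV f"
    using continuous_on_P_line[of UNIV "of_real \<eta> * \<i>" 1] shifted_line(1) unfolding f_def by simp
  have "f 0 \<le> e3" using P_imaginary_line_le[of \<eta>] half_periods_pos unfolding f_def by simp
  then have "f 0 < e1" using roots_less by linarith
  then show ?thesis
    using connected_image_avoids_gap[OF connected_UNIV cont roots_less(2) cases UNIV_I UNIV_I]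
    unfolding f_def by blast
qed

text \<open>The value at a half-period is a root of the cubic, and \<open>P_real_line_ge\<close>
  leaves only \<open>e1\<close>.\<close>

lemma P_half_period: "P (of_real \<omega>) = of_real e1"
proof -
  define X where "X = Re (P (of_real \<omega>))"
  have w: "\<omega> \<in> {0<..<2 * \<omega>}" using half_periods_pos by simp
  have PX: "P (of_real \<omega>) = of_real X" using real_line(2)[OF w] unfolding X_def by simp
  have "of_real ((X - e1) * (X - e2) * (X - e3)) = (0::complex)"
    using P_half_period_root[of "of_real \<omega>"] real_line(1)[OF w] generators_in_L(1) roots[of "of_real X"] PX
    by simp
  then have "(X - e1) * (X - e2) * (X - e3) = 0" unfolding of_real_eq_0_iff .
  moreover have "e1 \<le> X" using P_real_line_ge[OF w] unfolding X_def .
  ultimately have "X = e1" using roots_less by auto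
  then show ?thesis using PX by simp
qed

text \<open>When \<open>P\<close> agrees at \<open>z\<close> and
  \<open>z - of_real \<omega>\<close>, the product in \<open>P_translate_half_period\<close> becomes
  a square.\<close>

lemma P_quarter_period_square:
  assumes z: "z \<notin> L" "z - of_real \<omega> \<notin> L" "P (z - of_real \<omega>) = P z" "P z \<in> \<real>"
  shows "(Re (P z) - e1) ^ 2 = (e1 - e2) * (e1 - e3)"
proof -
  have w: "\<omega> \<in> {0<..<2 * \<omega>}" using half_periods_pos by simp
  have "(P (z - of_real \<omega> + of_real \<omega>) - of_real e1) * (P (z - of_real \<omega>) - of_real e1) =
      (of_real e1 - of_real e2) * (of_real e1 - of_real e3)"
    by (rule P_translate_half_period[OF real_line(1)[OF w] _ P_half_period roots])
      (use z roots_less generators_in_L(1) in auto)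
  then have "of_real ((Re (P z) - e1) ^ 2) = (of_real ((e1 - e2) * (e1 - e3)) :: complex)"
    using z(3,4) by (simp add: power2_eq_square)
  then show ?thesis unfolding of_real_eq_iff .
qed

lemma P_quarter_period: "P (of_real (\<omega> / 2)) = of_real (e1 + sqrt ((e1 - e2) * (e1 - e3)))"
proof -
  define z where "z = complex_of_real (\<omega> / 2)"
  have w: "\<omega> / 2 \<in> {0<..<2 * \<omega>}" using half_periods_pos by simp
  \<comment> \<open>At half of the half-period, translation by \<open>- \<omega>\<close> is
    reflection at 0, so evenness yields equal values. The sign of the root is then decided by
    \<open>P_real_line_ge\<close>.\<close>
  have z1: "z - of_real \<omega> = - z" unfolding z_def by (simp add: complex_eq_iff)
  have "(Re (P z) - e1) ^ 2 = (e1 - e2) * (e1 - e3)"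
    by (rule P_quarter_period_square)
      (unfold z1 uminus_L_iff P_even, use real_line[OF w] in \<open>auto simp: z_def\<close>)
  then have "sqrt ((e1 - e2) * (e1 - e3)) = \<bar>Re (P z) - e1\<bar>" by (metis real_sqrt_abs)
  also have "\<dots> = Re (P z) - e1" using P_real_line_ge[OF w] unfolding z_def by simp
  finally have "Re (P z) = e1 + sqrt ((e1 - e2) * (e1 - e3))" by simp
  then show ?thesis using real_line(2)[OF w] unfolding z_def by (metis of_real_Re)
qed

lemma P_quarter_period_shifted:
  "P (of_real (\<omega> / 2) + of_real \<eta> * \<i>) = of_real (e1 - sqrt ((e1 - e2) * (e1 - e3)))"
proof -
  define z where "z = of_real \<eta> * \<i> + of_real (\<omega> / 2)"
  \<comment> \<open>Again a reflection, now up to a period; here \<open>P_shifted_line_le\<close>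
    selects the negative root.\<close>
  have z1: "z - of_real \<omega> = - z + of_real (2 * \<eta>) * \<i>" unfolding z_def by (simp add: complex_eq_iff)
  have "(Re (P z) - e1) ^ 2 = (e1 - e2) * (e1 - e3)"
    by (rule P_quarter_period_square)
      (unfold z1 add_L_iff[OF generators_in_L(2)] uminus_L_iff P_periodic[OF generators_in_L(2)] P_even,
       use shifted_line[of "\<omega> / 2"] in \<open>auto simp: z_def\<close>)
  then have "sqrt ((e1 - e2) * (e1 - e3)) = \<bar>Re (P z) - e1\<bar>" by (metis real_sqrt_abs)
  also have "\<dots> = e1 - Re (P z)"
    using P_shifted_line_le[of "\<omega> / 2"] roots_less unfolding z_def by simp
  finally have "Re (P z) = e1 - sqrt ((e1 - e2) * (e1 - e3))" by simp
  then have "P z = of_real (e1 - sqrt ((e1 - e2) * (e1 - e3)))"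
    using shifted_line(2)[of "\<omega> / 2"] unfolding z_def by (metis of_real_Re)
  then show ?thesis unfolding z_def by (simp add: add.commute)
qed

end

subsection \<open>The elliptic function \<open>y\<close>\<close>

text \<open>The identity theorem applies after \<open>remove_sings\<close>. The conclusion concerns
  punctured neighbourhoods because the original values at singular points are arbitrary.\<close>

lemma meromorphic_eventually_zero:
  assumes f: "f meromorphic_on UNIV" and ev: "eventually (\<lambda>z. f z = 0) (at a)"
  shows "eventually (\<lambda>w. f w = 0) (at z)"
proof -
  have iso: "isolated_singularity_at f z" for z
    by (rule meromorphic_on_isolated_singularity) (use f meromorphic_on_subset in blast)
  have "eventually (\<lambda>z. remove_sings f z = 0) (at a)"
    using eventually_remove_sings_eq_at[OF iso] ev by eventually_elim simp
  then have "frequently (\<lambda>z. remove_sings f z = 0) (at a)"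
    by (intro eventually_frequently) auto
  then have zero: "remove_sings f w = 0" for w
    by (rule frequently_eq_meromorphic_imp_constant[OF _ remove_sings_nicely_meromorphic[OF f]]) auto
  show ?thesis using eventually_remove_sings_eq_at[OF iso, of z] by (rule eventually_mono) (metis zero)
qed

lemma (in period_lattice) P_meromorphic: "P meromorphic_on UNIV"
proof -
  have "P meromorphic_on {z}" for z
  proof (cases "z \<in> L")
    case False
    then have "P analytic_on {z}"
      using P_holomorphic open_complement_L analytic_at by blast
    then show ?thesis by (rule analytic_on_imp_meromorphic_on)
  next
    case True
    have "open (- (L - {z}))" by (rule open_Compl, rule closed_subset_L) auto
    then obtain r where r: "r > 0" "ball z r \<subseteq> - (L - {z})"
      using open_contains_ball[of "- (L - {z})"] by auto
    then have "ball z r - {z} \<subseteq> - L" by blast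
    then have "P holomorphic_on ball z r - {z}" using P_holomorphic holomorphic_on_subset by blast
    moreover have "open (ball z r - {z})" by (intro open_Diff) auto
    ultimately have "P analytic_on ball z r - {z}" by (simp add: analytic_on_open)
    then show ?thesis
      using r(1) is_pole_P[OF True] unfolding meromorphic_at_iff isolated_singularity_at_def by blast
  qed
  then show ?thesis using meromorphic_on_meromorphic_at by blast
qed

text \<open>The quartic is carried to the Weierstrass cubic by expanding at its root \<open>a\<close>.\<close>

lemma quartic_to_cubic:
  fixes a k u m :: complex
  assumes "2 * a ^ 2 = 1 + k" "m = 1 - k ^ 2" "u \<noteq> 0"
  shows "(8 * (a + 4 * a * k / u) ^ 4 - 8 * (a + 4 * a * k / u) ^ 2 + 2 * m) * u ^ 4 =
    (4 * a * k) ^ 2 * (4 * (4 / 3 + 2 * k + u) ^ 3 - 16 / 3 * (1 + 3 * m) * (4 / 3 + 2 * k + u)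
      - 64 / 27 * (1 - 9 * m))"
proof -
  \<comment> \<open>The quartic is even, so \<open>a\<close> enters through \<open>a ^ 2\<close>
    alone and \<open>2 * a ^ 2 = 1 + k\<close> eliminates it.\<close>
  have "(a + 4 * a * k / u) ^ 2 * u ^ 2 = a ^ 2 * (u + 4 * k) ^ 2"
    using assms(3) by (simp add: field_simps flip: power_mult_distrib)
  then have sq: "2 * ((a + 4 * a * k / u) ^ 2 * u ^ 2) = (1 + k) * (u + 4 * k) ^ 2"
    using assms(1) by (simp flip: mult.assoc)
  define s where "s = (a + 4 * a * k / u) ^ 2"
  have "(8 * (a + 4 * a * k / u) ^ 4 - 8 * (a + 4 * a * k / u) ^ 2 + 2 * m) * u ^ 4 =
      2 * (2 * (s * u ^ 2)) ^ 2 - 4 * (2 * (s * u ^ 2)) * u ^ 2 + 2 * m * u ^ 4"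
    unfolding s_def by (simp add: algebra_simps flip: power_mult power_add)
  also have "\<dots> = 2 * ((1 + k) * (u + 4 * k) ^ 2) ^ 2 - 4 * ((1 + k) * (u + 4 * k) ^ 2) * u ^ 2
      + 2 * (1 - k ^ 2) * u ^ 4"
    unfolding s_def sq assms(2) ..
  also have "\<dots> = 8 * (1 + k) * k ^ 2 * (4 * (4 / 3 + 2 * k + u) ^ 3
      - 16 / 3 * (1 + 3 * (1 - k ^ 2)) * (4 / 3 + 2 * k + u) - 64 / 27 * (1 - 9 * (1 - k ^ 2)))"
    by (simp add: field_simps power_numeral_reduce)
  also have "8 * (1 + k) * k ^ 2 = (4 * a * k) ^ 2"
    unfolding assms(1)[symmetric] by (simp add: power_mult_distrib)
  finally show ?thesis unfolding assms(2) .
qed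

theorem theorem8:
  fixes \<kappa> l :: real
    and y P :: "complex \<Rightarrow> complex"
    and \<Omega> \<Omega>' :: complex
  assumes "0 < \<kappa>" and "\<kappa> < 1"
    and "l = sqrt (1 - \<kappa> ^ 2)"
    and "meromorphic_T4_solution l y"
    and "\<not> y constant_on UNIV"
    and "y 0 = of_real (sqrt (1 / 2 * (1 + \<kappa>)))"
    and "is_weierstrass_p_with_invariants P
           (of_real (16 / 3 * (1 + 3 * l ^ 2))) (of_real (64 / 27 * (1 - 9 * l ^ 2)))"
    and "fundamental_pair_of_periods P (2 * \<Omega>) (2 * \<Omega>')"
    and "\<Omega> \<in> \<real>" and "Re \<Omega> > 0"
    and "- \<i> * \<Omega>' \<in> \<real>" and "Re (- \<i> * \<Omega>') > 0"
  shows "(y analytic_on {1 / 2 * \<Omega> + \<Omega>'} \<and> y (1 / 2 * \<Omega> + \<Omega>') = 0) \<and>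
         is_pole y (1 / 2 * \<Omega>)"
proof -
  obtain L0 where L0: "is_lattice L0" "lattice_invariant_g2 L0 = of_real (16 / 3 * (1 + 3 * l ^ 2))"
    "lattice_invariant_g3 L0 = of_real (64 / 27 * (1 - 9 * l ^ 2))" "P = weierstrass_p L0"
    using assms(7) unfolding is_weierstrass_p_with_invariants_def by blast
  obtain a b where ab: "b / a \<notin> \<real>" "L0 = lattice_gen a b" using L0(1) unfolding is_lattice_def by blast
  interpret A: period_lattice a b by unfold_locales (rule ab(1))
  define \<omega> where "\<omega> = Re \<Omega>"
  define \<eta> where "\<eta> = Im \<Omega>'"
  have \<Omega>: "\<Omega> = of_real \<omega>" using assms(9) unfolding \<omega>_def by simp
  have \<Omega>': "\<Omega>' = of_real \<eta> * \<i>"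
    using assms(11) unfolding \<eta>_def by (auto simp: complex_eq_iff complex_is_Real_iff)
  have pair: "of_real (2 * \<eta>) * \<i> / of_real (2 * \<omega>) \<notin> \<real>"
    "periods P = lattice_gen (of_real (2 * \<omega>)) (of_real (2 * \<eta>) * \<i>)"
    using assms(8) unfolding fundamental_pair_of_periods_def \<Omega> \<Omega>' by (simp_all add: mult.assoc)
  \<comment> \<open>\<open>P\<close> determines its lattice as its set of periods, so the lattice
    behind the invariants is the rectangular one.\<close>
  have L0_eq: "L0 = lattice_gen (of_real (2 * \<omega>)) (of_real (2 * \<eta>) * \<i>)"
    using A.periods_P pair(2) L0(4) ab(2) by simp
  have l2: "l ^ 2 = 1 - \<kappa> ^ 2" and l: "0 < l" "l < 1"
  proof -
    have "\<kappa> ^ 2 < 1" "0 < \<kappa> ^ 2" using assms(1,2) by (auto simp: power_less_one_iff)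
    then show "l ^ 2 = 1 - \<kappa> ^ 2" "0 < l" "l < 1" unfolding assms(3) by auto
  qed
  \<comment> \<open>These are the roots of the cubic with the prescribed invariants, ordered by
    \<open>0 < l\<close> and \<open>l < 1\<close>.\<close>
  interpret R: rectangular_lattice \<omega> \<eta> "4 / 3" "- 2 / 3 + 2 * l" "- 2 / 3 - 2 * l"
  proof unfold_locales
    show "of_real (2 * \<eta>) * \<i> / of_real (2 * \<omega>) \<notin> \<real>" by (rule pair(1))
    show "\<omega> > 0" "\<eta> > 0" using assms(10,12) unfolding \<omega>_def \<eta>_def by auto
    show "- 2 / 3 - 2 * l < - 2 / 3 + 2 * l" "- 2 / 3 + 2 * l < 4 / 3" using l by auto
    fix x :: complex
    show "4 * x ^ 3 - lattice_invariant_g2 (lattice_gen (of_real (2 * \<omega>)) (of_real (2 * \<eta>) * \<i>)) * x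
        - lattice_invariant_g3 (lattice_gen (of_real (2 * \<omega>)) (of_real (2 * \<eta>) * \<i>)) =
      4 * (x - of_real (4 / 3)) * (x - of_real (- 2 / 3 + 2 * l)) * (x - of_real (- 2 / 3 - 2 * l))"
      unfolding L0_eq[symmetric] L0(2,3) by (simp add: field_simps power_numeral_reduce)
  qed
  have P: "P = R.P" using L0(4) L0_eq by simp
  have invariants: "R.g2 = 16 / 3 * (1 + 3 * of_real l ^ 2)" "R.g3 = 64 / 27 * (1 - 9 * of_real l ^ 2)"
    using L0(2,3) unfolding L0_eq by simp_all
  have "(4 / 3 - (- 2 / 3 + 2 * l)) * (4 / 3 - (- 2 / 3 - 2 * l)) = 4 * (1 - l ^ 2)"
    by (simp add: field_simps power2_eq_square)
  also have "\<dots> = (2 * \<kappa>) ^ 2" unfolding l2 by (simp add: power_mult_distrib)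
  finally have root: "sqrt ((4 / 3 - (- 2 / 3 + 2 * l)) * (4 / 3 - (- 2 / 3 - 2 * l))) = 2 * \<kappa>"
    using assms(1) by (simp only: real_sqrt_abs)
  \<comment> \<open>The larger of the two quarter-period values of \<open>P\<close>; the pole of
    \<open>y\<close> sits where \<open>P\<close> takes it.\<close>
  define \<gamma> :: complex where "\<gamma> = 4 / 3 + 2 * of_real \<kappa>"
  have P_quarter: "P (1 / 2 * \<Omega>) = \<gamma>"
    using R.P_quarter_period unfolding P \<Omega> root \<gamma>_def by simp
  have P_shifted: "P (1 / 2 * \<Omega> + \<Omega>') = \<gamma> - 4 * of_real \<kappa>"
    using R.P_quarter_period_shifted unfolding P \<Omega> \<Omega>' root \<gamma>_def by simp

  define \<alpha> where "\<alpha> = y 0"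
  \<comment> \<open>The coefficient from \<open>quartic_to_cubic\<close>. With it
    \<open>\<alpha> + \<beta> / (P z - \<gamma>)\<close> vanishes where
    \<open>P z = \<gamma> - 4 * of_real \<kappa>\<close>.\<close>
  define \<beta> where "\<beta> = 4 * \<alpha> * of_real \<kappa>"
  have \<alpha>2: "2 * \<alpha> ^ 2 = 1 + of_real \<kappa>"
  proof -
    have "2 * (sqrt (1 / 2 * (1 + \<kappa>))) ^ 2 = 1 + \<kappa>" using assms(1) by simp
    then have "complex_of_real (2 * (sqrt (1 / 2 * (1 + \<kappa>))) ^ 2) = of_real (1 + \<kappa>)" by simp
    then show ?thesis unfolding \<alpha>_def assms(6) by simp
  qed
  have \<alpha>0: "\<alpha> \<noteq> 0" unfolding \<alpha>_def assms(6) using assms(1) by simp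
  have \<beta>0: "\<beta> \<noteq> 0" unfolding \<beta>_def using \<alpha>0 assms(1) by simp
  have y_mero: "y nicely_meromorphic_on UNIV"
    and y_ode: "\<And>z. \<not> is_pole y z \<Longrightarrow> (deriv y z) ^ 2 = 8 * y z ^ 4 - 8 * y z ^ 2 + 2 * of_real l ^ 2"
    using assms(4) unfolding meromorphic_T4_solution_def chebyshev_T4_def by auto
  have y_cases: "is_pole y z \<and> y z = 0 \<or> y \<midarrow>z\<rightarrow> y z" for z
    using y_mero unfolding nicely_meromorphic_on_def by blast
  \<comment> \<open>At a pole a nicely meromorphic function has the value 0 by convention, whereas
    \<open>y 0 = \<alpha>\<close> is nonzero.\<close>
  have "\<not> is_pole y 0"
    using y_cases[of 0] \<alpha>0 not_tendsto_and_filterlim_at_infinity[of "at 0" y]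
    unfolding \<alpha>_def is_pole_def by auto
  then have "y analytic_on {0}" by (rule nicely_meromorphic_on_imp_analytic_at[OF y_mero UNIV_I])
  then obtain R where R: "R > 0" "y holomorphic_on ball 0 R" unfolding analytic_on_def by blast
  have no_pole: "\<not> is_pole y z" if "z \<in> ball 0 R" for z
    using R(2) that analytic_at analytic_at_imp_no_pole open_ball by blast
  define p where "p = [:2 * of_real l ^ 2, 0, - 8, 0, 8 :: complex:]"
  have p: "poly p x = 8 * x ^ 4 - 8 * x ^ 2 + 2 * of_real l ^ 2" for x
    unfolding p_def by (simp add: algebra_simps power_numeral_reduce)
  have l2c: "complex_of_real l ^ 2 = 1 - of_real \<kappa> ^ 2"
    using arg_cong[OF l2, of complex_of_real] by simp
  obtain s where s: "s > 0" "\<And>z. z \<in> ball 0 s - {0} \<Longrightarrow> (y z - \<alpha>) * (R.P z - \<gamma>) = \<beta>"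
  proof (rule R.Moebius_of_P[of \<beta> p \<alpha> \<gamma> R y])
    show "poly p \<alpha> = 0"
    proof -
      have "poly p \<alpha> = 2 * (2 * \<alpha> ^ 2) ^ 2 - 4 * (2 * \<alpha> ^ 2) + 2 * of_real l ^ 2"
        unfolding p by (simp flip: power_mult)
      also have "\<dots> = 0" unfolding \<alpha>2 l2c by (simp add: algebra_simps power2_eq_square)
      finally show ?thesis .
    qed
    show "poly p (\<alpha> + \<beta> / u) * u ^ 4 = \<beta> ^ 2 * (4 * (\<gamma> + u) ^ 3 - R.g2 * (\<gamma> + u) - R.g3)"
      if "u \<noteq> 0" for u
      unfolding p \<beta>_def \<gamma>_def invariants by (rule quartic_to_cubic[OF \<alpha>2 l2c that])
    show "(deriv y z) ^ 2 = poly p (y z)" if "z \<in> ball 0 R" for z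
      unfolding p by (rule y_ode[OF no_pole[OF that]])
    show "\<not> y constant_on ball 0 s" if s: "s > 0" for s
    proof
      assume "y constant_on ball 0 s"
      then obtain c where c: "\<And>z. z \<in> ball 0 s \<Longrightarrow> y z = c" unfolding constant_on_def by blast
      have "eventually (\<lambda>z. z \<in> ball 0 s) (at (0::complex))"
        by (rule eventually_at_in_open') (use s in auto)
      then have "eventually (\<lambda>z. y z = c) (at 0)" by eventually_elim (rule c)
      then have "frequently (\<lambda>z. y z = c) (at 0)" by (intro eventually_frequently) auto
      then have "y w = c" for w
        by (rule frequently_eq_meromorphic_imp_constant[OF _ y_mero]) auto
      then show False using assms(5) unfolding constant_on_def by blast
    qed
  qed (use \<beta>0 R in \<open>auto simp: \<alpha>_def\<close>)

  \<comment> \<open>The relation between \<open>y\<close> and \<open>P\<close> is known near 0 only;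
    both functions are meromorphic, which spreads it to punctured neighbourhoods of every
    point.\<close>
  have "eventually (\<lambda>z. z \<in> ball 0 s - {0}) (at (0::complex))"
    by (rule eventually_at_in_open) (use s(1) in auto)
  then have "eventually (\<lambda>z. (y z - \<alpha>) * (P z - \<gamma>) - \<beta> = 0) (at 0)"
    by eventually_elim (use s(2) P in simp)
  moreover have "(\<lambda>z. (y z - \<alpha>) * (P z - \<gamma>) - \<beta>) meromorphic_on UNIV"
    using y_mero R.P_meromorphic unfolding nicely_meromorphic_on_def P by (intro meromorphic_intros) auto
  ultimately have "eventually (\<lambda>w. (y w - \<alpha>) * (P w - \<gamma>) - \<beta> = 0) (at z)" for z
    by (rule meromorphic_eventually_zero[rotated])
  \<comment> \<open>The product equals \<open>\<beta> \<noteq> 0\<close>, so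
    \<open>P w \<noteq> \<gamma>\<close> near \<open>z\<close> and the relation can be solved for
    \<open>y w\<close>.\<close>
  then have rel: "eventually (\<lambda>w. \<alpha> + \<beta> / (P w - \<gamma>) = y w \<and> P w - \<gamma> \<noteq> 0) (at z)" for z
  proof (rule eventually_mono)
    fix w assume w: "(y w - \<alpha>) * (P w - \<gamma>) - \<beta> = 0"
    then have "P w - \<gamma> \<noteq> 0" using \<beta>0 by auto
    then show "\<alpha> + \<beta> / (P w - \<gamma>) = y w \<and> P w - \<gamma> \<noteq> 0" using w by (simp add: field_simps)
  qed
  have P_tendsto: "P \<midarrow>z\<rightarrow> P z" if "z \<notin> R.L" for z
    using R.P_has_deriv[OF that] DERIV_isCont unfolding P isCont_def by blast

  define z1 where "z1 = 1 / 2 * \<Omega> + \<Omega>'"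
  define z2 where "z2 = 1 / 2 * \<Omega>"
  have "z1 \<notin> R.L"
    using R.shifted_line(1)[of "\<omega> / 2"] unfolding z1_def \<Omega> \<Omega>' by (simp add: add.commute)
  then have "P \<midarrow>z1\<rightarrow> \<gamma> - 4 * of_real \<kappa>" using P_tendsto P_shifted unfolding z1_def by metis
  then have "(\<lambda>w. \<alpha> + \<beta> / (P w - \<gamma>)) \<midarrow>z1\<rightarrow> \<alpha> + \<beta> / (\<gamma> - 4 * of_real \<kappa> - \<gamma>)"
    using assms(1) by (intro tendsto_intros) auto
  moreover have "\<alpha> + \<beta> / (\<gamma> - 4 * of_real \<kappa> - \<gamma>) = 0" unfolding \<beta>_def using assms(1) by simp
  ultimately have y_z1: "y \<midarrow>z1\<rightarrow> 0"
    using Lim_transform_eventually[OF _ eventually_mono[OF rel]] by fastforce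
  \<comment> \<open>The value 0 would also fit a pole, by convention; the finite limit rules this
    out.\<close>
  then have no_pole_z1: "\<not> is_pole y z1"
    unfolding is_pole_def using not_tendsto_and_filterlim_at_infinity[of "at z1" y] by auto
  then have "y z1 = 0" using y_cases[of z1] y_z1 LIM_unique by blast
  moreover have "y analytic_on {z1}"
    by (rule nicely_meromorphic_on_imp_analytic_at[OF y_mero UNIV_I no_pole_z1])

  moreover have "is_pole y z2"
  proof -
    have "z2 \<notin> R.L"
      using R.real_line(1)[of "\<omega> / 2"] R.half_periods_pos unfolding z2_def \<Omega> by simp
    then have "P \<midarrow>z2\<rightarrow> \<gamma>" using P_tendsto P_quarter unfolding z2_def by metis
    then have "(\<lambda>w. P w - \<gamma>) \<midarrow>z2\<rightarrow> \<gamma> - \<gamma>" by (intro tendsto_intros)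
    \<comment> \<open>By \<open>rel\<close>, \<open>P w\<close> tends to \<open>\<gamma>\<close>
      without attaining it near \<open>z2\<close>, so \<open>\<beta> / (P w - \<gamma>)\<close>
      tends to infinity.\<close>
    then have "filterlim (\<lambda>w. P w - \<gamma>) (at 0) (at z2)"
      by (intro filterlim_atI) (use rel[of z2] in \<open>auto elim!: eventually_mono\<close>)
    then have "filterlim (\<lambda>w. \<alpha> + \<beta> / (P w - \<gamma>)) at_infinity (at z2)"
      by (intro tendsto_add_filterlim_at_infinity[OF tendsto_const]
          filterlim_divide_at_infinity[OF tendsto_const _ \<beta>0])
    moreover have "eventually (\<lambda>w. \<alpha> + \<beta> / (P w - \<gamma>) = y w) (at z2)"
      using rel[of z2] by eventually_elim simp
    ultimately show ?thesis unfolding is_pole_def by (subst (asm) filterlim_cong[OF refl refl])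
  qed
  ultimately show ?thesis unfolding z1_def z2_def by blast
qed

end
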